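(* Let $\phi\colon A_1\to A_2$ be an order conserving star extendible embedding between finite dimensional nest algebras, where $A_1$ has no rank one atoms. Then $\phi$ can be written as an ordered sum $\phi=\phi_1+\dots+\phi_p$, where each $\phi_i$ is either of $T_2$-degenerate type or of refinement type.
   Context: A finite dimensional nest algebra is a unital algebra $A\subseteq M_n(\mathbb{C})$ (or an operator algebra star extendibly isomorphic to one) associated with an ordered decomposition $1=q_1+\dots+q_l$ of the identity into nonzero orthogonal projections: $A$ consists of all $a\in M_n(\mathbb{C})$ with $(1-f)af=0$ for every $f=q_1+\dots+q_k$, $1\le k\le l$. The $q_i$ are the atomic interval projections (atoms) of $A$, totally ordered by $q_i\prec_A q_j$ for $i<j$; $A$ is the algebra of block upper triangular matrices for the block structure $v=(q_ivq_j)$, and $C^*(A)=M_n(\mathbb{C})$. $T_n\subseteq M_n(\mathbb{C})$ is the upper triangular matrix algebra (all atoms of rank one). A homomorphism (embedding, possibly nonunital) $A_1\to A_2$ is star extendible if it is the restriction of a $*$-homomorphism $C^*(A_1)\to C^*(A_2)$. $\mathrm{Pisom}_{\mathrm{reg}}(A)$ is the set of partial isometries $v\in A$ all of whose blocks $q_ivq_j$ are partial isometries. $\mathrm{Pisom}_{\mathrm{oc}}(A)$ (order conserving partial isometries) is the set of $v\in \mathrm{Pisom}_{\mathrm{reg}}(A)$ such that $q_ivq_j\neq 0$ implies $q_svq_t=0$ for all $s<i$, $t>j$. A star extendible embedding $\phi\colon A_1\to A_2$ is order conserving if it maps $\mathrm{Pisom}_{\mathrm{oc}}(A_1)$ into $\mathrm{Pisom}_{\mathrm{oc}}(A_2)$,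 and locally order conserving if $\phi(v)\in\mathrm{Pisom}_{\mathrm{oc}}(A_2)$ for each rank one $v\in\mathrm{Pisom}_{\mathrm{reg}}(A_1)$. Ordered sums: if $\phi_1,\dots,\phi_r\colon A_1\to A_2$ are star extendible with pairwise orthogonal projections $\phi_i(1)$, then $\phi_1+\dots+\phi_r$ is an ordered sum if for all atoms $q\prec q'$ of $A_2$ and all $j<i$, $q\phi_i(1)\neq0$ implies $q'\phi_j(1)=0$. Refinement type: a star extendible embedding $\phi\colon T_n\to T_m$ is of refinement type if it is locally order conserving and, whenever $e_1\prec_{T_n}e_2$ are distinct atoms of $T_n$, one has $f_1\prec_{T_m}f_2$ for all atoms $f_1\le\phi(e_1)$, $f_2\le\phi(e_2)$ of $T_m$. A star extendible embedding $\phi\colon A_1\to A_2$ of finite dimensional nest algebras is of refinement type if there are maximal triangular subalgebras $T_n\subseteq A_1$, $T_m\subseteq A_2$ (where $C^*(A_1)\cong M_n(\mathbb{C})$, $C^*(A_2)\cong M_m(\mathbb{C})$) with $\phi(T_n)\subseteq T_m$ such that $\phi|_{T_n}\colon T_n\to T_m$ is of refinement type. $\phi$ is of $T_2$-degenerate type if there are atoms $Q,Q'$ of $A_2$ with $\phi(1)\le Q+Q'$. *)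

theory Defs
  imports "HOL-Analysis.Analysis"
begin

text \<open>
  \<open>M\<^sub>n(\<complex>)\<close> is the type \<open>complex^'n^'n\<close> with product \<open>**\<close>. Its identity is \<open>mat 1\<close> and
  scalar multiplication by \<open>c\<close> is \<open>mat c ** a\<close>; beware that the overloaded \<open>1\<close> and \<open>*\<close> on
  this type are componentwise.
\<close>

definition adj :: "complex^'n^'n \<Rightarrow> complex^'n^'n" where
  "adj a = (\<chi> i j. cnj (a $ j $ i))"

text \<open>The operator order. On \<open>complex^'n\<close> the inner product \<open>\<bullet>\<close> is the real part of the
  Hermitian one, which loses nothing for the Hermitian matrix \<open>b - a\<close>.\<close>

definition op_le :: "complex^'n^'n \<Rightarrow> complex^'n^'n \<Rightarrow> bool" where
  "op_le a b \<longleftrightarrow> adj (b - a) = b - a \<and> (\<forall>x. 0 \<le> x \<bullet> ((b - a) *v x))"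

definition projection :: "complex^'n^'n \<Rightarrow> bool" where
  "projection p \<longleftrightarrow> p ** p = p \<and> adj p = p"

definition partial_isometry :: "complex^'n^'n \<Rightarrow> bool" where
  "partial_isometry v \<longleftrightarrow> projection (adj v ** v)"

subsection \<open>Nest algebras\<close>

text \<open>
  A finite dimensional nest algebra is presented by the list \<open>q\<close> of its atoms in increasing
  order; list positions start at \<open>0\<close>, so the atoms are \<open>q ! i\<close> for \<open>i < length q\<close>, and
  \<open>q ! i\<close> precedes \<open>q ! j\<close> iff \<open>i < j\<close>. The notions below that depend on an algebra
  take its list of atoms as argument.
\<close>

definition ordered_decomposition :: "(complex^'n^'n) list \<Rightarrow> bool" where
  "ordered_decomposition q \<longleftrightarrow>
     (\<forall>p \<in> set q. projection p \<and> p \<noteq> 0) \<and>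
     (\<forall>i < length q. \<forall>j < length q. i \<noteq> j \<longrightarrow> q ! i ** q ! j = 0) \<and>
     sum_list q = mat 1"

definition nest_alg :: "(complex^'n^'n) list \<Rightarrow> (complex^'n^'n) set" where
  "nest_alg q = {a. \<forall>k \<in> {1..length q}.
     (mat 1 - sum_list (take k q)) ** a ** sum_list (take k q) = 0}"

definition Pisom_reg :: "(complex^'n^'n) list \<Rightarrow> (complex^'n^'n) set" where
  "Pisom_reg q = {v \<in> nest_alg q. partial_isometry v \<and>
     (\<forall>i < length q. \<forall>j < length q. partial_isometry (q ! i ** v ** q ! j))}"

definition Pisom_oc :: "(complex^'n^'n) list \<Rightarrow> (complex^'n^'n) set" where
  "Pisom_oc q = {v \<in> Pisom_reg q. \<forall>i < length q. \<forall>j < length q.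
     q ! i ** v ** q ! j \<noteq> 0 \<longrightarrow>
     (\<forall>s < i. \<forall>t. j < t \<and> t < length q \<longrightarrow> q ! s ** v ** q ! t = 0)}"

subsection \<open>Star extendible maps\<close>

definition star_hom :: "(complex^'n^'n \<Rightarrow> complex^'m^'m) \<Rightarrow> bool" where
  "star_hom \<Phi> \<longleftrightarrow>
     (\<forall>a b. \<Phi> (a + b) = \<Phi> a + \<Phi> b) \<and>
     (\<forall>c a. \<Phi> (mat c ** a) = mat c ** \<Phi> a) \<and>
     (\<forall>a b. \<Phi> (a ** b) = \<Phi> a ** \<Phi> b) \<and>
     (\<forall>a. \<Phi> (adj a) = adj (\<Phi> a))"

text \<open>
  The C*-algebra generated by a nest algebra in \<open>M\<^sub>n(\<complex>)\<close> is all of \<open>M\<^sub>n(\<complex>)\<close>, so the extension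
  is a map between full matrix algebras. Only the values of \<open>\<phi>\<close> on \<open>nest_alg q\<close> matter,
  here and in every later definition.
\<close>

definition star_extendible ::
  "(complex^'n^'n) list \<Rightarrow> (complex^'m^'m) list \<Rightarrow> (complex^'n^'n \<Rightarrow> complex^'m^'m) \<Rightarrow> bool" where
  "star_extendible q r \<phi> \<longleftrightarrow>
     \<phi> ` nest_alg q \<subseteq> nest_alg r \<and> (\<exists>\<Phi>. star_hom \<Phi> \<and> (\<forall>a \<in> nest_alg q. \<phi> a = \<Phi> a))"

definition star_extendible_embedding ::
  "(complex^'n^'n) list \<Rightarrow> (complex^'m^'m) list \<Rightarrow> (complex^'n^'n \<Rightarrow> complex^'m^'m) \<Rightarrow> bool" where
  "star_extendible_embedding q r \<phi> \<longleftrightarrow> star_extendible q r \<phi> \<and> inj_on \<phi> (nest_alg q)"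

definition order_conserving ::
  "(complex^'n^'n) list \<Rightarrow> (complex^'m^'m) list \<Rightarrow> (complex^'n^'n \<Rightarrow> complex^'m^'m) \<Rightarrow> bool" where
  "order_conserving q r \<phi> \<longleftrightarrow> \<phi> ` Pisom_oc q \<subseteq> Pisom_oc r"

definition locally_order_conserving ::
  "(complex^'n^'n) list \<Rightarrow> (complex^'m^'m) list \<Rightarrow> (complex^'n^'n \<Rightarrow> complex^'m^'m) \<Rightarrow> bool" where
  "locally_order_conserving q r \<phi> \<longleftrightarrow> (\<forall>v \<in> Pisom_reg q. rank v = 1 \<longrightarrow> \<phi> v \<in> Pisom_oc r)"

text \<open>\<open>\<phi>\<close> is the ordered sum of the maps \<open>\<psi> 0, \<dots>, \<psi> (p - 1)\<close>.\<close>

definition is_ordered_sum ::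
  "(complex^'n^'n) list \<Rightarrow> (complex^'m^'m) list \<Rightarrow> (complex^'n^'n \<Rightarrow> complex^'m^'m) \<Rightarrow>
   nat \<Rightarrow> (nat \<Rightarrow> complex^'n^'n \<Rightarrow> complex^'m^'m) \<Rightarrow> bool" where
  "is_ordered_sum q r \<phi> p \<psi> \<longleftrightarrow>
     (\<forall>i < p. star_extendible q r (\<psi> i)) \<and>
     (\<forall>i < p. \<forall>j < p. i \<noteq> j \<longrightarrow> \<psi> i (mat 1) ** \<psi> j (mat 1) = 0) \<and>
     (\<forall>a \<in> nest_alg q. \<phi> a = (\<Sum>i<p. \<psi> i a)) \<and>
     (\<forall>k l. k < l \<and> l < length r \<longrightarrow> (\<forall>i < p. \<forall>j < i.
        r ! k ** \<psi> i (mat 1) \<noteq> 0 \<longrightarrow> r ! l ** \<psi> j (mat 1) = 0))"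

subsection \<open>Maximal triangular subalgebras\<close>

definition subalgebra :: "(complex^'n^'n) set \<Rightarrow> bool" where
  "subalgebra S \<longleftrightarrow> mat 1 \<in> S \<and>
     (\<forall>a \<in> S. \<forall>b \<in> S. a + b \<in> S \<and> a ** b \<in> S) \<and> (\<forall>c. \<forall>a \<in> S. mat c ** a \<in> S)"

definition abelian_selfadjoint :: "(complex^'n^'n) set \<Rightarrow> bool" where
  "abelian_selfadjoint D \<longleftrightarrow> subalgebra D \<and> adj ` D \<subseteq> D \<and> (\<forall>a \<in> D. \<forall>b \<in> D. a ** b = b ** a)"

definition masa :: "(complex^'n^'n) set \<Rightarrow> bool" where
  "masa D \<longleftrightarrow> abelian_selfadjoint D \<and> (\<forall>E. abelian_selfadjoint E \<and> D \<subseteq> E \<longrightarrow> E = D)"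

text \<open>Triangularity in the sense of Kadison and Singer.\<close>

definition triangular :: "(complex^'n^'n) set \<Rightarrow> bool" where
  "triangular T \<longleftrightarrow> subalgebra T \<and> masa (T \<inter> adj ` T)"

definition maximal_triangular_subalgebra :: "(complex^'n^'n) set \<Rightarrow> (complex^'n^'n) set \<Rightarrow> bool" where
  "maximal_triangular_subalgebra T A \<longleftrightarrow>
     triangular T \<and> T \<subseteq> A \<and> (\<forall>S. triangular S \<and> S \<subseteq> A \<and> T \<subseteq> S \<longrightarrow> S = T)"

text \<open>Lists of rank one atoms present the copies of the upper triangular algebra \<open>T\<^sub>n\<close> in \<open>M\<^sub>n(\<complex>)\<close>.\<close>

definition rank_one_decomposition :: "(complex^'n^'n) list \<Rightarrow> bool" where
  "rank_one_decomposition e \<longleftrightarrow> ordered_decomposition e \<and> (\<forall>p \<in> set e. rank p = 1)"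

subsection \<open>The two types of embedding\<close>

definition refinement_type_triangular ::
  "(complex^'n^'n) list \<Rightarrow> (complex^'m^'m) list \<Rightarrow> (complex^'n^'n \<Rightarrow> complex^'m^'m) \<Rightarrow> bool" where
  "refinement_type_triangular e f \<phi> \<longleftrightarrow>
     star_extendible_embedding e f \<phi> \<and> locally_order_conserving e f \<phi> \<and>
     (\<forall>i j. i < j \<and> j < length e \<longrightarrow> (\<forall>k < length f. \<forall>l < length f.
        op_le (f ! k) (\<phi> (e ! i)) \<and> op_le (f ! l) (\<phi> (e ! j)) \<longrightarrow> k < l))"

definition refinement_type ::
  "(complex^'n^'n) list \<Rightarrow> (complex^'m^'m) list \<Rightarrow> (complex^'n^'n \<Rightarrow> complex^'m^'m) \<Rightarrow> bool" where
  "refinement_type q r \<phi> \<longleftrightarrow> star_extendible_embedding q r \<phi> \<and>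
     (\<exists>e f. rank_one_decomposition e \<and> maximal_triangular_subalgebra (nest_alg e) (nest_alg q) \<and>
            rank_one_decomposition f \<and> maximal_triangular_subalgebra (nest_alg f) (nest_alg r) \<and>
            \<phi> ` nest_alg e \<subseteq> nest_alg f \<and> refinement_type_triangular e f \<phi>)"

text \<open>The atoms \<open>Q\<close> and \<open>Q'\<close> may coincide; then \<open>\<phi>(1) \<le> 2Q\<close>, that is, \<open>\<phi>(1) \<le> Q\<close>.\<close>

definition T2_degenerate_type ::
  "(complex^'n^'n) list \<Rightarrow> (complex^'m^'m) list \<Rightarrow> (complex^'n^'n \<Rightarrow> complex^'m^'m) \<Rightarrow> bool" where
  "T2_degenerate_type q r \<phi> \<longleftrightarrow> star_extendible_embedding q r \<phi> \<and>
     (\<exists>Q \<in> set r. \<exists>Q' \<in> set r. op_le (\<phi> (mat 1)) (Q + Q'))"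

end

theory Submission
  imports Defs "HOL-Library.List_Lexorder"
begin

text \<open>
  Write \<open>\<Phi> a = a \<otimes> 1\<close> on the range of \<open>E = \<Phi> 1\<close>, with multiplicity space \<open>K\<close>. Since \<open>\<Phi>\<close> maps
  the diagonal of the first algebra into that of the second, each atom \<open>r\<^sub>s\<close> of the second
  algebra acts on \<open>\<Phi> q\<^sub>k\<close> as \<open>1 \<otimes> R\<^sub>k\<^sub>s\<close>. Regularity of the images of matrix units makes the
  projections \<open>R\<^sub>k\<^sub>s\<close> commute, so \<open>K\<close> has a basis of common eigenvectors, each of which
  determines a function \<open>f\<close> from the atoms \<open>k\<close> to the atoms \<open>s\<close>. These functions are monotone,
  and order conservation of matrix units makes them a chain. As the atoms have rank at least
  two, \<open>e\<^sub>d\<^sub>d + e\<^sub>c\<^sub>c'\<close> with \<open>d\<close> in the block of \<open>c\<close> or of \<open>c'\<close> is an order conserving partial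
  isometry too, so no value \<open>g i\<close> or \<open>g j\<close> lies strictly between \<open>f i\<close> and \<open>f j\<close>. Hence
  either the ranges of \<open>f\<close> and \<open>g\<close> follow one another, or \<open>f\<close> and \<open>g\<close> have the same first
  value \<open>a\<close> and the same last value \<open>b\<close>, and if moreover \<open>f \<noteq> g\<close> then both take no other values.
  Cutting \<open>K\<close> by the pair \<open>(a, b)\<close> gives the summands: several functions with the same
  pair give a \<open>T\<^sub>2\<close>-degenerate summand, a single function gives a summand of refinement type.
\<close>

section \<open>Hermitian inner product and rank one matrices\<close>

lemma matrix_sum_mult_vec: "(\<Sum>i\<in>I. A i) *v x = (\<Sum>i\<in>I. A i *v x)"
  for A :: "'i \<Rightarrow> complex^'n^'m"
  by (induction I rule: infinite_finite_induct) (auto simp: matrix_vector_mult_add_rdistrib)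

lemma matrix_mult_vec_sum: "A *v (\<Sum>i\<in>I. x i) = (\<Sum>i\<in>I. A *v x i)"
  for A :: "complex^'n^'m"
  by (induction I rule: infinite_finite_induct) (auto simp: matrix_vector_right_distrib)

lemma matrix_sum_mult_left: "(\<Sum>i\<in>I. A i) ** B = (\<Sum>i\<in>I. A i ** B)"
  for A :: "'i \<Rightarrow> complex^'n^'m" and B :: "complex^'k^'n"
  by (simp add: matrix_eq matrix_vector_mul_assoc[symmetric] matrix_sum_mult_vec)

lemma matrix_sum_mult_right: "B ** (\<Sum>i\<in>I. A i) = (\<Sum>i\<in>I. B ** A i)"
  for A :: "'i \<Rightarrow> complex^'n^'m" and B :: "complex^'m^'k"
  by (simp add: matrix_eq matrix_vector_mul_assoc[symmetric] matrix_sum_mult_vec matrix_mult_vec_sum)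

lemma matrix_diff_ldistrib: "A ** (B - C) = A ** B - A ** C"
  for A :: "complex^'n^'m" and B C :: "complex^'k^'n"
  by (simp add: matrix_eq matrix_vector_mul_assoc[symmetric] matrix_vector_mult_diff_rdistrib
      matrix_vector_mult_diff_distrib)

lemma matrix_diff_rdistrib: "(B - C) ** A = B ** A - C ** A"
  for A :: "complex^'n^'m" and B C :: "complex^'m^'k"
  by (simp add: matrix_eq matrix_vector_mul_assoc[symmetric] matrix_vector_mult_diff_rdistrib)

lemma matrix_add_rdistrib: "(B + C) ** A = B ** A + C ** A"
  for A :: "complex^'n^'m" and B C :: "complex^'m^'k"
  by (simp add: matrix_eq matrix_vector_mul_assoc[symmetric] matrix_vector_mult_add_rdistrib)

lemma mat_mult_vec [simp]: "mat c *v x = c *s x"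
  for x :: "complex^'n"
  by (simp add: vec_eq_iff matrix_vector_mult_def mat_def if_distrib[of "\<lambda>y. y * _"] cong: if_cong)

lemma mat_mult_commute: "A ** mat c = mat c ** A"
  for A :: "complex^'n^'n"
  by (simp add: matrix_eq matrix_vector_mul_assoc[symmetric] vector_scalar_commute)

lemma mat_mult_mat: "mat c ** mat d = (mat (c * d) :: complex^'n^'n)"
  by (simp add: matrix_eq matrix_vector_mul_assoc[symmetric])

lemma mat_nonzero_mult_eq_0_iff: "mat c ** A = 0 \<longleftrightarrow> c = 0 \<or> A = 0"
  for A :: "complex^'n^'n"
proof
  assume "mat c ** A = 0"
  then have "mat (inverse c) ** (mat c ** A) = 0" by simp
  then show "c = 0 \<or> A = 0"
    by (cases "c = 0") (auto simp: matrix_mul_assoc mat_mult_mat)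
qed (auto simp: matrix_eq matrix_vector_mul_assoc[symmetric])

section \<open>Adjoints, the Hermitian form and projections\<close>

lemma adj_adj [simp]: "adj (adj a) = a"
  by (simp add: adj_def vec_eq_iff)

lemma adj_mult: "adj (a ** b) = adj b ** adj a"
  by (simp add: adj_def vec_eq_iff matrix_matrix_mult_def mult.commute)

lemma adj_add: "adj (a + b) = adj a + adj b"
  and adj_diff: "adj (a - b) = adj a - adj b"
  and adj_0 [simp]: "adj 0 = 0"
  by (simp_all add: adj_def vec_eq_iff)

lemma adj_mat [simp]: "adj (mat c) = mat (cnj c)"
  by (simp add: adj_def vec_eq_iff mat_def)

lemma adj_sum: "adj (\<Sum>i\<in>I. A i) = (\<Sum>i\<in>I. adj (A i))"
  by (induction I rule: infinite_finite_induct) (auto simp: adj_add)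

text \<open>Linear in the second argument. It is kept apart from \<open>\<bullet>\<close>, which on
  complex vectors is only its real part and does not detect complex orthogonality.\<close>

definition cinner :: "complex^'n \<Rightarrow> complex^'n \<Rightarrow> complex" where
  "cinner x y = (\<Sum>i\<in>UNIV. cnj (x $ i) * y $ i)"

lemma cinner_add_right: "cinner x (y + z) = cinner x y + cinner x z"
  and cinner_diff_right: "cinner x (y - z) = cinner x y - cinner x z"
  by (simp_all add: cinner_def algebra_simps sum.distrib sum_subtractf)

lemma cinner_scale_right [simp]: "cinner x (c *s y) = c * cinner x y"
  and cinner_scale_left [simp]: "cinner (c *s x) y = cnj c * cinner x y"
  by (simp_all add: cinner_def algebra_simps sum_distrib_left)

lemma cinner_zero [simp]: "cinner x 0 = 0" "cinner 0 x = 0"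
  by (simp_all add: cinner_def)

lemma cinner_sum_right: "cinner x (\<Sum>i\<in>I. f i) = (\<Sum>i\<in>I. cinner x (f i))"
  by (induction I rule: infinite_finite_induct) (auto simp: cinner_add_right)

lemma cinner_commute: "cinner y x = cnj (cinner x y)"
  by (simp add: cinner_def mult.commute)

lemma cinner_self: "cinner x x = of_real ((norm x)\<^sup>2)"
  by (simp add: cinner_def norm_vec_def L2_set_def sum_nonneg complex_norm_square mult.commute
      del: of_real_power)

lemma cinner_self_eq_0_iff [simp]: "cinner x x = 0 \<longleftrightarrow> x = 0"
  by (simp add: cinner_self)

lemma cinner_adj: "cinner x (a *v y) = cinner (adj a *v x) y"
proof -
  have "cinner x (a *v y) = (\<Sum>i\<in>UNIV. \<Sum>j\<in>UNIV. cnj (x $ i) * (a $ i $ j * y $ j))"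
    by (simp add: cinner_def matrix_vector_mult_def sum_distrib_left)
  also have "\<dots> = (\<Sum>j\<in>UNIV. \<Sum>i\<in>UNIV. cnj (x $ i) * (a $ i $ j * y $ j))"
    by (rule sum.swap)
  also have "\<dots> = cinner (adj a *v x) y"
    by (simp add: cinner_def matrix_vector_mult_def adj_def sum_distrib_right sum_distrib_left mult_ac)
  finally show ?thesis .
qed

lemma inner_eq_Re_cinner: "x \<bullet> y = Re (cinner x y)"
  for x y :: "complex^'n"
  by (simp add: cinner_def inner_vec_def inner_complex_def)

lemma exists_unit_multiple:
  assumes "x \<noteq> 0"
  shows "\<exists>c. c \<noteq> 0 \<and> cinner (c *s x) (c *s x) = 1"
proof -
  have "cinner ((1 / of_real (norm x)) *s x) ((1 / of_real (norm x)) *s x) = 1"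
    using assms
    by (simp add: cinner_self[of x] power2_eq_square)
  then show ?thesis using assms by (intro exI[of _ "1 / of_real (norm x)"]) auto
qed

lemma adj_mult_self_eq_0: "adj a ** a = 0 \<Longrightarrow> a = 0"
proof -
  assume "adj a ** a = 0"
  then have "cinner (a *v x) (a *v x) = 0" for x
    by (simp add: cinner_adj matrix_vector_mul_assoc)
  then show "a = 0" by (simp add: matrix_eq)
qed

lemma projection_0 [simp]: "projection 0"
  by (simp add: projection_def)

lemma projection_cinner: "projection p \<Longrightarrow> cinner (p *v x) y = cinner x (p *v y)"
  by (simp add: projection_def cinner_adj)

lemma projection_idem: "projection p \<Longrightarrow> p *v (p *v x) = p *v x"
  by (simp add: projection_def matrix_vector_mul_assoc)

lemma projection_mult:
  assumes "projection p" "projection p'" "p ** p' = p' ** p"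
  shows "projection (p ** p')"
  using assms unfolding projection_def by (metis adj_mult matrix_mul_assoc)

lemma projection_diff:
  assumes "projection p" "projection p'" "p ** p' = p'"
  shows "projection (p - p')"
proof -
  have "p' ** p = p'" using assms unfolding projection_def by (metis adj_mult)
  then show ?thesis
    using assms by (simp add: projection_def matrix_diff_ldistrib matrix_diff_rdistrib adj_diff)
qed

lemma projection_add:
  assumes "projection p" "projection p'" "p ** p' = 0"
  shows "projection (p + p')"
proof -
  have "p' ** p = 0" using assms unfolding projection_def by (metis adj_mult adj_0)
  then show ?thesis
    using assms by (simp add: projection_def matrix_add_ldistrib matrix_add_rdistrib adj_add)
qed

text \<open>For \<open>d = p ** s - s ** p ** s\<close>, idempotence of the compression makes
  \<open>adj d ** d\<close> vanish. So \<open>p ** s\<close> equals the selfadjoint compression, and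
  hence its own adjoint \<open>s ** p\<close>.\<close>

lemma projection_compression_commute:
  assumes "projection p" "projection s" "projection (s ** p ** s)"
  shows "p ** s = s ** p"
proof -
  have p: "p ** p = p" "adj p = p" and s: "s ** s = s" "adj s = s"
    using assms by (auto simp: projection_def)
  have e: "s ** p ** s ** p ** s = s ** p ** s"
    using assms(3) s(1) unfolding projection_def by (metis matrix_mul_assoc)
  have e': "s ** (p ** (s ** (p ** s))) = s ** (p ** s)"
    using e by (simp add: matrix_mul_assoc)
  have pp: "p ** (p ** x) = p ** x" and ss: "s ** (s ** x) = s ** x" for x
    by (metis matrix_mul_assoc p(1)) (metis matrix_mul_assoc s(1))
  have "adj (p ** s - s ** p ** s) ** (p ** s - s ** p ** s) = 0"
    by (simp add: adj_diff adj_mult p s matrix_diff_ldistrib matrix_diff_rdistrib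
        matrix_mul_assoc[symmetric] pp ss e')
  then have "p ** s = s ** p ** s" using adj_mult_self_eq_0 by force
  then show ?thesis by (metis adj_mult matrix_mul_assoc p(2) s(2))
qed

section \<open>Rank one matrices\<close>

text \<open>The operator \<open>z \<mapsto> cinner y z *s x\<close>; for vectors of an orthonormal
  basis these are the matrix units.\<close>

definition outer :: "complex^'n \<Rightarrow> complex^'m \<Rightarrow> complex^'m^'n" where
  "outer x y = (\<chi> i j. x $ i * cnj (y $ j))"

lemma outer_mult_vec [simp]: "outer x y *v z = cinner y z *s x"
  by (simp add: outer_def cinner_def matrix_vector_mult_def vec_eq_iff sum_distrib_left
      sum_distrib_right mult_ac)

lemma mult_outer: "a ** outer x y = outer (a *v x) y"
  by (simp add: matrix_eq matrix_vector_mul_assoc[symmetric] vector_scalar_commute)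

lemma outer_mult: "outer x y ** a = outer x (adj a *v y)"
  by (simp add: matrix_eq matrix_vector_mul_assoc[symmetric] cinner_adj)

lemma outer_mult_outer: "outer x y ** outer z w = mat (cinner y z) ** outer x w"
  by (simp add: matrix_eq matrix_vector_mul_assoc[symmetric])

lemma adj_outer [simp]: "adj (outer x y) = outer y x"
  by (simp add: adj_def outer_def vec_eq_iff)

lemma outer_zero [simp]: "outer 0 y = 0" "outer x 0 = 0"
  by (simp_all add: outer_def vec_eq_iff)

lemma outer_eq_0_iff: "outer x y = 0 \<longleftrightarrow> x = 0 \<or> y = 0"
proof
  assume "outer x y = 0"
  then have "outer x y *v y = 0" by simp
  then show "x = 0 \<or> y = 0" by (simp add: vec_eq_iff) (metis)
qed auto

lemma projection_outer: "cinner x x = 1 \<Longrightarrow> projection (outer x x)"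
  by (simp add: projection_def outer_mult_outer)

text \<open>All rows are multiples of the conjugate of \<open>y\<close>, and a nonzero coordinate of
  \<open>x\<close> makes one of them nonzero, so the row space is a line.\<close>

lemma rank_outer:
  assumes "x \<noteq> 0" "y \<noteq> 0"
  shows "rank (outer x y) = 1"
proof -
  let ?y = "\<chi> j. cnj (y $ j)"
  have y: "?y \<noteq> 0" using assms(2) by (auto simp: vec_eq_iff)
  have rw: "row i (outer x y) = (x $ i) *s ?y" for i
    by (simp add: row_def outer_def vec_eq_iff)
  obtain i where i: "x $ i \<noteq> 0" using assms(1) by (auto simp: vec_eq_iff)
  have "vec.span (rows (outer x y)) = vec.span {?y}"
  proof (rule vec.span_eq[THEN iffD2], intro conjI subsetI)
    fix z assume "z \<in> rows (outer x y)"
    then show "z \<in> vec.span {?y}"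
      by (auto simp: rows_def rw intro: vec.span_scale vec.span_base)
  next
    fix z assume "z \<in> {?y}"
    then have z: "z = (1 / x $ i) *s row i (outer x y)" using i by (simp add: rw)
    have "row i (outer x y) \<in> rows (outer x y)" by (auto simp: rows_def)
    then show "z \<in> vec.span (rows (outer x y))"
      unfolding z by (intro vec.span_scale vec.span_base)
  qed
  then have "vec.dim (rows (outer x y)) = vec.dim {?y}"
    by (metis vec.dim_span)
  also have "\<dots> = 1"
    using y by (subst vec.dim_eq_card_independent) (auto simp: vec.dependent_single)
  finally show ?thesis by (simp add: row_rank_def_gen)
qed

text \<open>The rows are multiples of one spanning vector \<open>z\<close>; the coefficients form
  the left vector and the conjugate of \<open>z\<close> the right one.\<close>

lemma rank_1_imp_outer:
  fixes a :: "complex^'n^'m"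
  assumes "rank a = 1"
  shows "\<exists>x y. a = outer x y"
proof -
  obtain B where B: "B \<subseteq> rows a" "vec.independent B" "rows a \<subseteq> vec.span B" "card B = 1"
    using vec.basis_exists[of "rows a"] assms unfolding row_rank_def_gen by metis
  then obtain z where z: "B = {z}" by (auto simp: card_1_singleton_iff)
  have "\<exists>c. row i a = c *s z" for i
  proof -
    have "row i a \<in> vec.span {z}" using B(3) z by (auto simp: rows_def)
    then show ?thesis by (auto simp: vec.span_singleton)
  qed
  then obtain c where c: "\<And>i. row i a = c i *s z" by metis
  have "a = outer (\<chi> i. c i) (\<chi> j. cnj (z $ j))"
    using c by (simp add: vec_eq_iff row_def outer_def)
  then show ?thesis by blast
qed

text \<open>Orthonormal bases are indexed by a finite set of a linear order; the order is that of
  the list of rank one atoms.\<close>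

definition orthonormal_on :: "'k set \<Rightarrow> ('k \<Rightarrow> complex^'n) \<Rightarrow> bool" where
  "orthonormal_on I w \<longleftrightarrow> finite I \<and> (\<forall>i\<in>I. \<forall>j\<in>I. cinner (w i) (w j) = (if i = j then 1 else 0))"

lemma orthonormal_onD:
  "orthonormal_on I w \<Longrightarrow> i \<in> I \<Longrightarrow> j \<in> I \<Longrightarrow> cinner (w i) (w j) = (if i = j then 1 else 0)"
  by (auto simp: orthonormal_on_def)

text \<open>Induction on the real dimension of the range: subtracting \<open>outer x x\<close> for a
  unit vector \<open>x\<close> of the range leaves a projection whose range no longer contains
  \<open>x\<close>.\<close>

lemma projection_decomposition:
  fixes p :: "complex^'n^'n"
  assumes "projection p"
  shows "\<exists>d (v :: nat \<Rightarrow> complex^'n). orthonormal_on {..<d} v \<and> p = (\<Sum>s<d. outer (v s) (v s))"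
  using assms
proof (induction "dim (range ((*v) p))" arbitrary: p rule: less_induct)
  case less
  show ?case
  proof (cases "p = 0")
    case True
    then show ?thesis by (intro exI[of _ 0]) (auto simp: orthonormal_on_def)
  next
    case False
    then obtain y where y: "p *v y \<noteq> 0" by (auto simp: matrix_eq)
    obtain c where c: "cinner (c *s (p *v y)) (c *s (p *v y)) = 1"
      using exists_unit_multiple[OF y] by blast
    define x where "x = c *s (p *v y)"
    have x: "cinner x x = 1" "p *v x = x"
      using c by (auto simp: x_def vector_scalar_commute projection_idem[OF less.prems])
    define p' where "p' = p - outer x x"
    have px: "p ** outer x x = outer x x" by (simp add: mult_outer x)
    have p': "projection p'"
      unfolding p'_def by (rule projection_diff[OF less.prems projection_outer[OF x(1)] px])
    have pp': "p ** p' = p'"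
      using less.prems by (simp add: p'_def matrix_diff_ldistrib px projection_def)
    have p'x: "p' *v x = 0" by (simp add: p'_def matrix_vector_mult_diff_rdistrib x)
    have sub: "range ((*v) p') \<subseteq> range ((*v) p)"
      using pp' by (metis image_subsetI matrix_vector_mul_assoc rangeI)
    have "x \<notin> range ((*v) p')"
    proof
      assume "x \<in> range ((*v) p')"
      then obtain z where "x = p' *v z" by blast
      then have "p' *v x = x" by (simp add: projection_idem[OF p'])
      then show False using p'x x(1) by simp
    qed
    moreover have "x \<in> range ((*v) p)" using x(2) by (metis rangeI)
    ultimately have "range ((*v) p') \<subset> range ((*v) p)" using sub by blast
    moreover have "subspace (range ((*v) a))" for a :: "complex^'n^'n"
      by (intro linear_subspace_image matrix_vector_mul_linear subspace_UNIV)
    ultimately have "dim (range ((*v) p')) < dim (range ((*v) p))"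
      by (metis dim_psubset span_eq_iff)
    from less.hyps[OF this p'] obtain d v where
      v: "orthonormal_on {..<d::nat} v" "p' = (\<Sum>s<d. outer (v s) (v s))" by blast
    have vx: "cinner (v s) x = 0" if "s < d" for s
    proof -
      have "p' *v v s = (\<Sum>t<d. (if t = s then v s else 0))"
        unfolding v(2) matrix_sum_mult_vec
        by (rule sum.cong) (use that orthonormal_onD[OF v(1)] in auto)
      also have "\<dots> = v s" using that by simp
      finally have "cinner (v s) x = cinner (p' *v v s) x" by simp
      then show ?thesis by (simp add: projection_cinner[OF p'] p'x)
    qed
    have xv: "cinner x (v s) = 0" if "s < d" for s
      using vx[OF that] cinner_commute[of x "v s"] by simp
    have "orthonormal_on {..<Suc d} (v(d := x))"
      using v(1) vx xv x(1) by (auto simp: orthonormal_on_def less_Suc_eq)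
    moreover have "p = (\<Sum>s<Suc d. outer ((v(d := x)) s) ((v(d := x)) s))"
      using v(2) by (simp add: p'_def algebra_simps)
    ultimately show ?thesis by blast
  qed
qed

lemma outer_sum_fixes:
  assumes "orthonormal_on I w" "i \<in> I"
  shows "(\<Sum>j\<in>I. outer (w j) (w j)) *v w i = w i"
proof -
  have "(\<Sum>j\<in>I. outer (w j) (w j)) *v w i = (\<Sum>j\<in>I. if j = i then w i else 0)"
    unfolding matrix_sum_mult_vec
    by (rule sum.cong) (use assms orthonormal_onD[OF assms(1)] in auto)
  then show ?thesis using assms by (simp add: orthonormal_on_def)
qed

section \<open>Nest algebras in orthonormal bases\<close>

lemma
  assumes "ordered_decomposition q"
  shows ordered_decomposition_projection: "i < length q \<Longrightarrow> projection (q ! i)"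
    and ordered_decomposition_nonzero: "i < length q \<Longrightarrow> q ! i \<noteq> 0"
    and ordered_decomposition_mult: "i < length q \<Longrightarrow> j < length q \<Longrightarrow>
      q ! i ** q ! j = (if i = j then q ! i else 0)"
    and ordered_decomposition_sum: "(\<Sum>i<length q. q ! i) = mat 1"
  using assms by (auto simp: ordered_decomposition_def projection_def sum_list_sum_nth atLeast0LessThan)

lemma ordered_decomposition_mult_vec:
  assumes "ordered_decomposition q" "i < length q" "j < length q"
  shows "q ! i *v (q ! j *v x) = (if i = j then q ! i *v x else 0)"
  using ordered_decomposition_mult[OF assms] by (simp add: matrix_vector_mul_assoc)

text \<open>The complement of a partial sum of atoms is the sum of the later atoms, so each defining
  condition is a sum of blocks below the diagonal. Conversely, multiplying the condition for the cut
  after position \<open>j\<close> by the two atoms isolates the block in row \<open>i\<close> and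
  column \<open>j\<close>.\<close>

lemma nest_alg_iff:
  assumes q: "ordered_decomposition q"
  shows "x \<in> nest_alg q \<longleftrightarrow> (\<forall>i<length q. \<forall>j<i. q ! i ** x ** q ! j = 0)"
proof -
  let ?F = "\<lambda>k. sum_list (take k q)"
  have F: "?F k = (\<Sum>i<k. q ! i)" if "k \<le> length q" for k
    using that by (simp add: sum_list_sum_nth atLeast0LessThan min_absorb2)
  have F': "mat 1 - ?F k = (\<Sum>i\<in>{k..<length q}. q ! i)" if "k \<le> length q" for k
    using sum.atLeastLessThan_concat[of 0 k "length q" "\<lambda>i. q ! i"] that
    by (simp add: F ordered_decomposition_sum[OF q, symmetric] atLeast0LessThan algebra_simps)
  have l: "q ! i ** ?F k = (if i < k then q ! i else 0)"
    and r: "?F k ** q ! i = (if i < k then q ! i else 0)"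
    if "i < length q" "k \<le> length q" for i k
  proof -
    have "q ! i ** ?F k = (\<Sum>j<k. if j = i then q ! i else 0)"
      unfolding F[OF that(2)] matrix_sum_mult_right
      by (rule sum.cong) (use that ordered_decomposition_mult[OF q] in auto)
    then show "q ! i ** ?F k = (if i < k then q ! i else 0)" by simp
    have "?F k ** q ! i = (\<Sum>j<k. if j = i then q ! i else 0)"
      unfolding F[OF that(2)] matrix_sum_mult_left
      by (rule sum.cong) (use that ordered_decomposition_mult[OF q] in auto)
    then show "?F k ** q ! i = (if i < k then q ! i else 0)" by simp
  qed
  show ?thesis
  proof (intro iffI allI impI)
    fix i j assume x: "x \<in> nest_alg q" and ij: "i < length q" "j < i"
    then have "(mat 1 - ?F (Suc j)) ** x ** ?F (Suc j) = 0"
      by (auto simp: nest_alg_def)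
    then have "q ! i ** ((mat 1 - ?F (Suc j)) ** x ** ?F (Suc j)) ** q ! j = 0" by simp
    moreover have "q ! i ** (mat 1 - ?F (Suc j)) = q ! i"
      using ij by (simp add: matrix_diff_ldistrib l)
    moreover have "?F (Suc j) ** q ! j = q ! j" using ij by (simp add: r)
    ultimately show "q ! i ** x ** q ! j = 0" by (metis matrix_mul_assoc)
  next
    assume *: "\<forall>i<length q. \<forall>j<i. q ! i ** x ** q ! j = 0"
    have "(mat 1 - ?F k) ** x ** ?F k = 0" if "k \<le> length q" for k
      unfolding F'[OF that] unfolding F[OF that] matrix_sum_mult_right matrix_sum_mult_left
      using * by (auto intro!: sum.neutral)
    then show "x \<in> nest_alg q" by (simp add: nest_alg_def)
  qed
qed

text \<open>Membership of \<open>x\<close> removes the blocks of \<open>x\<close> below the diagonal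
  and membership of \<open>adj x\<close> those above it, so \<open>x\<close> is block
  diagonal.\<close>

lemma nest_alg_diagonal_commute:
  assumes q: "ordered_decomposition q" and x: "x \<in> nest_alg q" "adj x \<in> nest_alg q"
    and k: "k < length q"
  shows "q ! k ** x = x ** q ! k"
proof -
  have p: "projection (q ! i)" if "i < length q" for i
    using ordered_decomposition_projection[OF q that] .
  have z: "q ! i ** x ** q ! j = 0" if ij: "i < length q" "j < length q" "i \<noteq> j" for i j
  proof (cases "j < i")
    case True
    then show ?thesis using x(1) ij by (simp add: nest_alg_iff[OF q])
  next
    case False
    then have "q ! j ** adj x ** q ! i = 0" using x(2) ij by (simp add: nest_alg_iff[OF q])
    then have "adj (q ! j ** adj x ** q ! i) = 0" by simp
    then show ?thesis
      using p ij by (simp add: adj_mult projection_def matrix_mul_assoc)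
  qed
  have "q ! k ** x = q ! k ** x ** (\<Sum>j<length q. q ! j)"
    by (simp add: ordered_decomposition_sum[OF q])
  also have "\<dots> = (\<Sum>j<length q. if j = k then q ! k ** x ** q ! k else 0)"
    unfolding matrix_sum_mult_right by (rule sum.cong) (use z k in auto)
  also have "\<dots> = (\<Sum>j<length q. q ! j ** x ** q ! k)"
    using z k by (intro sum.cong) auto
  also have "\<dots> = (\<Sum>j<length q. q ! j) ** x ** q ! k"
    by (simp add: matrix_sum_mult_left)
  finally show ?thesis by (simp add: ordered_decomposition_sum[OF q])
qed

section \<open>Matrix coefficients in an orthonormal basis\<close>

definition orthonormal_basis :: "'k set \<Rightarrow> ('k \<Rightarrow> complex^'n) \<Rightarrow> bool" where
  "orthonormal_basis I w \<longleftrightarrow> orthonormal_on I w \<and> (\<Sum>i\<in>I. outer (w i) (w i)) = mat 1"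

definition entry :: "('k \<Rightarrow> complex^'n) \<Rightarrow> complex^'n^'n \<Rightarrow> 'k \<Rightarrow> 'k \<Rightarrow> complex" where
  "entry w x i j = cinner (w i) (x *v w j)"

lemma outer_sandwich: "outer (w i) (w i) ** x ** outer (w j) (w j) = mat (entry w x i j) ** outer (w i) (w j)"
  by (simp add: entry_def mult_outer matrix_vector_mul_assoc[symmetric])

lemma entry_add: "entry w (x + y) i j = entry w x i j + entry w y i j"
  and entry_scale: "entry w (mat c ** x) i j = c * entry w x i j"
  and entry_adj: "entry w (adj x) i j = cnj (entry w x j i)"
  and entry_sum: "entry w (\<Sum>s\<in>S. f s) i j = (\<Sum>s\<in>S. entry w (f s) i j)"
  by (simp_all add: entry_def matrix_vector_mult_add_rdistrib cinner_add_right mult.commute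
      matrix_vector_mul_assoc[symmetric] cinner_adj[of _ "adj x"] cinner_commute[of _ "w j"]
      matrix_sum_mult_vec cinner_sum_right)

lemma entry_outer: "entry w (outer y z) i j = cinner (w i) y * cinner z (w j)"
  by (simp add: entry_def mult.commute)

context
  fixes I :: "'k set" and w :: "'k \<Rightarrow> complex^'n"
  assumes w: "orthonormal_basis I w"
begin

lemma basis_finite: "finite I"
  and basis_cinner: "i \<in> I \<Longrightarrow> j \<in> I \<Longrightarrow> cinner (w i) (w j) = (if i = j then 1 else 0)"
  and basis_sum: "(\<Sum>i\<in>I. outer (w i) (w i)) = mat 1"
  using w by (auto simp: orthonormal_basis_def orthonormal_on_def)

lemma basis_nonzero: "i \<in> I \<Longrightarrow> w i \<noteq> 0"
  using basis_cinner[of i i] by auto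

lemma basis_expand_vec: "x = (\<Sum>i\<in>I. cinner (w i) x *s w i)"
proof -
  have "x = (\<Sum>i\<in>I. outer (w i) (w i)) *v x" by (simp add: basis_sum)
  then show ?thesis by (simp add: matrix_sum_mult_vec)
qed

lemma basis_vec_eqI:
  assumes "\<And>i. i \<in> I \<Longrightarrow> cinner (w i) x = cinner (w i) y"
  shows "x = y"
  by (subst basis_expand_vec, subst (2) basis_expand_vec) (simp add: assms)

lemma basis_matrix_eqI:
  assumes "\<And>i. i \<in> I \<Longrightarrow> a *v w i = b *v w i"
  shows "a = b"
proof -
  have "a *v x = b *v x" for x
    by (subst (1 2) basis_expand_vec)
       (simp add: matrix_mult_vec_sum vector_scalar_commute assms)
  then show ?thesis by (simp add: matrix_eq)
qed

lemma basis_entry_eqI: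
  assumes "\<And>i j. i \<in> I \<Longrightarrow> j \<in> I \<Longrightarrow> entry w a i j = entry w b i j"
  shows "a = b"
  using assms by (intro basis_matrix_eqI basis_vec_eqI) (auto simp: entry_def)

lemma entry_unit: "i \<in> I \<Longrightarrow> j \<in> I \<Longrightarrow> i' \<in> I \<Longrightarrow> j' \<in> I \<Longrightarrow>
    entry w (outer (w i) (w j)) i' j' = (if i = i' \<and> j = j' then 1 else 0)"
  by (auto simp: entry_outer basis_cinner)

lemma entry_1: "i \<in> I \<Longrightarrow> j \<in> I \<Longrightarrow> entry w (mat 1) i j = (if i = j then 1 else 0)"
  by (simp add: entry_def basis_cinner)

lemma entry_mult: "entry w (a ** b) i j = (\<Sum>k\<in>I. entry w a i k * entry w b k j)"
proof -
  have "entry w (a ** b) i j = cinner (w i) (a *v (\<Sum>k\<in>I. cinner (w k) (b *v w j) *s w k))"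
    by (subst basis_expand_vec[of "b *v w j", symmetric])
       (simp add: entry_def matrix_vector_mul_assoc)
  then show ?thesis
    by (simp add: entry_def matrix_mult_vec_sum cinner_sum_right vector_scalar_commute mult.commute)
qed

lemma basis_expand_matrix: "a = (\<Sum>i\<in>I. \<Sum>j\<in>I. mat (entry w a i j) ** outer (w i) (w j))"
proof -
  have "a = (\<Sum>i\<in>I. outer (w i) (w i)) ** a ** (\<Sum>j\<in>I. outer (w j) (w j))"
    by (simp add: basis_sum)
  also have "\<dots> = (\<Sum>j\<in>I. \<Sum>i\<in>I. outer (w i) (w i) ** a ** outer (w j) (w j))"
    by (simp only: matrix_sum_mult_left matrix_sum_mult_right)
  also have "\<dots> = (\<Sum>i\<in>I. \<Sum>j\<in>I. outer (w i) (w i) ** a ** outer (w j) (w j))"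
    by (rule sum.swap)
  finally show ?thesis unfolding outer_sandwich[of w] .
qed

text \<open>Reflexivity of \<open>R\<close> gives the unit and transitivity closes the pattern under
  products, as for incidence algebras. Equality gives the diagonal algebra, \<open>\<le>\<close> the
  triangular one.\<close>

lemma subalgebra_pattern:
  assumes "\<And>i. i \<in> I \<Longrightarrow> R i i"
    and "\<And>i j k. i \<in> I \<Longrightarrow> j \<in> I \<Longrightarrow> k \<in> I \<Longrightarrow> R i j \<Longrightarrow> R j k \<Longrightarrow> R i k"
  shows "subalgebra {x. \<forall>i\<in>I. \<forall>j\<in>I. \<not> R i j \<longrightarrow> entry w x i j = 0}"
    (is "subalgebra ?S")
  unfolding subalgebra_def
proof (intro conjI ballI allI)
  show "mat 1 \<in> ?S" using assms(1) by (auto simp: entry_1)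
next
  fix a b assume ab: "a \<in> ?S" "b \<in> ?S"
  then show "a + b \<in> ?S" by (simp add: entry_add)
  have "entry w a i k * entry w b k j = 0" if "i \<in> I" "j \<in> I" "k \<in> I" "\<not> R i j" for i j k
    using ab assms(2)[of i k j] that by auto
  then show "a ** b \<in> ?S" by (auto simp: entry_mult intro!: sum.neutral)
next
  fix c a assume "a \<in> ?S"
  then show "mat c ** a \<in> ?S" by (simp add: entry_scale)
qed

text \<open>A matrix commuting with the projections \<open>outer (w j) (w j)\<close> has every
  \<open>w j\<close> as an eigenvector and is diagonal, so no larger commutative algebra contains
  this one.\<close>

lemma masa_diagonal: "masa {x. \<forall>i\<in>I. \<forall>j\<in>I. i \<noteq> j \<longrightarrow> entry w x i j = 0}" (is "masa ?D")
proof -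
  have diag: "entry w (a ** b) i j = (if i = j then entry w a i i * entry w b i i else 0)"
    if "a \<in> ?D" "b \<in> ?D" "i \<in> I" "j \<in> I" for a b i j
  proof -
    have "entry w (a ** b) i j
      = (\<Sum>k\<in>I. if k = i then entry w a i i * entry w b i j else 0)"
      unfolding entry_mult by (rule sum.cong) (use that in auto)
    then show ?thesis using that basis_finite by auto
  qed
  have "abelian_selfadjoint ?D"
    unfolding abelian_selfadjoint_def
  proof (intro conjI ballI)
    show "subalgebra ?D" using subalgebra_pattern[of "(=)"] by simp
    show "adj ` ?D \<subseteq> ?D" by (auto simp: entry_adj)
    fix a b assume "a \<in> ?D" "b \<in> ?D"
    then show "a ** b = b ** a"
      by (intro basis_entry_eqI) (simp only: diag mult.commute)
  qed
  moreover have "E = ?D" if E: "abelian_selfadjoint E" "?D \<subseteq> E" for E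
  proof -
    have "x \<in> ?D" if x: "x \<in> E" for x
    proof -
      have "entry w x i j = 0" if ij: "i \<in> I" "j \<in> I" "i \<noteq> j" for i j
      proof -
        have "outer (w j) (w j) \<in> E" using E(2) ij by (auto simp: entry_unit)
        then have "x ** outer (w j) (w j) = outer (w j) (w j) ** x"
          using E(1) x by (auto simp: abelian_selfadjoint_def)
        then have "x *v (outer (w j) (w j) *v w j) = outer (w j) (w j) *v (x *v w j)"
          by (simp only: matrix_vector_mul_assoc)
        then have "x *v w j = cinner (w j) (x *v w j) *s w j"
          using ij by (simp add: basis_cinner)
        then have "cinner (w i) (x *v w j) = cinner (w i) (cinner (w j) (x *v w j) *s w j)"
          by (rule arg_cong)
        then show ?thesis using ij by (simp add: entry_def basis_cinner)
      qed
      then show ?thesis by blast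
    qed
    then show ?thesis using E(2) by blast
  qed
  ultimately show ?thesis unfolding masa_def by blast
qed

end

section \<open>Triangular algebras of ordered bases\<close>

definition atom_list :: "'k::linorder set \<Rightarrow> ('k \<Rightarrow> complex^'n) \<Rightarrow> (complex^'n^'n) list" where
  "atom_list I w = map (\<lambda>i. outer (w i) (w i)) (sorted_list_of_set I)"

lemma sorted_list_of_set_nth_less_iff:
  assumes "finite I" "p < card I" "p' < card I"
  shows "sorted_list_of_set I ! p < sorted_list_of_set I ! p' \<longleftrightarrow> p < p'"
proof -
  have less: "sorted_list_of_set I ! a < sorted_list_of_set I ! b" if "a < b" "b < card I" for a b
    using that assms(1) strict_sorted_list_of_set[of I] by (simp add: sorted_wrt_iff_nth_less)
  show ?thesis
    using less[of p p'] less[of p' p] assms by (metis less_asym' linorder_neqE_nat)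
qed

lemma sorted_list_of_set_nth_mem:
  "finite I \<Longrightarrow> p < card I \<Longrightarrow> sorted_list_of_set I ! p \<in> I"
  by (metis length_sorted_list_of_set nth_mem set_sorted_list_of_set)

lemma sorted_list_of_set_nth_ex:
  "finite I \<Longrightarrow> i \<in> I \<Longrightarrow> \<exists>p<card I. sorted_list_of_set I ! p = i"
  by (metis in_set_conv_nth length_sorted_list_of_set set_sorted_list_of_set)

context
  fixes I :: "'k::linorder set" and w :: "'k \<Rightarrow> complex^'n"
  assumes w: "orthonormal_basis I w"
begin

private abbreviation ix where "ix p \<equiv> sorted_list_of_set I ! p"

private lemmas fin = basis_finite[OF w]
private lemmas ix_less = sorted_list_of_set_nth_less_iff[OF fin]
private lemmas ix_mem = sorted_list_of_set_nth_mem[OF fin]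
private lemmas ix_ex = sorted_list_of_set_nth_ex[OF fin]

lemma length_atom_list [simp]: "length (atom_list I w) = card I"
  by (simp add: atom_list_def)

lemma atom_list_nth: "p < card I \<Longrightarrow> atom_list I w ! p = outer (w (ix p)) (w (ix p))"
  by (simp add: atom_list_def)

lemma atom_list_rank_one_decomposition: "rank_one_decomposition (atom_list I w)"
  unfolding rank_one_decomposition_def ordered_decomposition_def
proof (intro conjI ballI allI impI)
  fix p assume "p \<in> set (atom_list I w)"
  then obtain i where i: "i \<in> I" "p = outer (w i) (w i)" using fin by (auto simp: atom_list_def)
  show "projection p" using i by (simp add: projection_outer basis_cinner[OF w])
  show "p \<noteq> 0" using i by (simp add: outer_eq_0_iff basis_nonzero[OF w])
  show "rank p = 1" using i by (simp add: rank_outer basis_nonzero[OF w])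
next
  fix p p' assume "p < length (atom_list I w)" "p' < length (atom_list I w)" "p \<noteq> p'"
  then show "atom_list I w ! p ** atom_list I w ! p' = 0"
    using ix_less[of p p'] ix_less[of p' p]
    by (auto simp: atom_list_nth outer_mult_outer basis_cinner[OF w] ix_mem)
next
  have "sum_list (atom_list I w) = (\<Sum>i\<in>I. outer (w i) (w i))"
    unfolding atom_list_def using fin
    by (subst sum_list_distinct_conv_sum_set) auto
  then show "sum_list (atom_list I w) = mat 1" by (simp add: basis_sum[OF w])
qed

lemma atom_list_ordered_decomposition: "ordered_decomposition (atom_list I w)"
  using atom_list_rank_one_decomposition by (simp add: rank_one_decomposition_def)

lemma nest_alg_atom_list: "nest_alg (atom_list I w) = {x. \<forall>i\<in>I. \<forall>j\<in>I. \<not> i \<le> j \<longrightarrow> entry w x i j = 0}"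
proof -
  have "x \<in> nest_alg (atom_list I w) \<longleftrightarrow> (\<forall>p<card I. \<forall>p'<p. entry w x (ix p) (ix p') = 0)" for x
    by (simp add: nest_alg_iff[OF atom_list_ordered_decomposition] atom_list_nth outer_sandwich[of w]
        mat_nonzero_mult_eq_0_iff outer_eq_0_iff basis_nonzero[OF w] ix_mem)
  also have "\<dots> x \<longleftrightarrow> (\<forall>i\<in>I. \<forall>j\<in>I. \<not> i \<le> j \<longrightarrow> entry w x i j = 0)" for x
  proof (intro iffI ballI impI allI)
    fix i j assume *: "\<forall>p<card I. \<forall>p'<p. entry w x (ix p) (ix p') = 0" "i \<in> I" "j \<in> I" "\<not> i \<le> j"
    obtain p p' where "p < card I" "p' < card I" "ix p = i" "ix p' = j" using ix_ex * by metis
    then show "entry w x i j = 0" using * ix_less[of p' p] by auto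
  next
    fix p p' assume *: "\<forall>i\<in>I. \<forall>j\<in>I. \<not> i \<le> j \<longrightarrow> entry w x i j = 0" "p < card I" "p' < p"
    then show "entry w x (ix p) (ix p') = 0" using ix_less[of p' p] by (simp add: ix_mem)
  qed
  finally show ?thesis by blast
qed

text \<open>Maximality of the diagonal forces a triangular \<open>S\<close> above this algebra to
  have the same diagonal. A nonzero entry below the diagonal would, after compression and scaling,
  put a matrix unit into \<open>S\<close> whose adjoint lies there already, hence an off-diagonal
  matrix unit into the diagonal.\<close>

lemma atom_list_maximal_triangular:
  assumes "nest_alg (atom_list I w) \<subseteq> A"
  shows "maximal_triangular_subalgebra (nest_alg (atom_list I w)) A"
proof -
  let ?T = "nest_alg (atom_list I w)"
  let ?D = "{x. \<forall>i\<in>I. \<forall>j\<in>I. i \<noteq> j \<longrightarrow> entry w x i j = 0}"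
  have T: "subalgebra ?T"
    unfolding nest_alg_atom_list by (rule subalgebra_pattern[OF w]) auto
  have adj_iff: "x \<in> adj ` X \<longleftrightarrow> adj x \<in> X" for x :: "complex^'n^'n" and X
    by (metis (no_types, lifting) adj_adj image_iff)
  have D: "?T \<inter> adj ` ?T = ?D"
    unfolding set_eq_iff Int_iff adj_iff nest_alg_atom_list mem_Collect_eq entry_adj
    by (auto simp: not_le) (metis linorder_neq_iff)
  have "triangular ?T"
    unfolding triangular_def D using T masa_diagonal[OF w] by blast
  moreover have "S = ?T" if S: "triangular S" "?T \<subseteq> S" for S
  proof -
    have SD: "S \<inter> adj ` S = ?D"
    proof -
      have "?D \<subseteq> S \<inter> adj ` S" using S(2) unfolding D[symmetric] by blast
      moreover have "abelian_selfadjoint (S \<inter> adj ` S)"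
        using S(1) by (simp add: triangular_def masa_def)
      ultimately show ?thesis using masa_diagonal[OF w] unfolding masa_def by blast
    qed
    have "entry w x i j = 0" if x: "x \<in> S" and ij: "i \<in> I" "j \<in> I" "\<not> i \<le> j" for x i j
    proof (rule ccontr)
      assume c: "entry w x i j \<noteq> 0"
      have sub: "subalgebra S" using S(1) by (simp add: triangular_def)
      have e: "outer (w k) (w k') \<in> S" if "k \<in> I" "k' \<in> I" "k \<le> k'" for k k'
        using S(2) that by (auto simp: nest_alg_atom_list entry_unit[OF w])
      have "outer (w i) (w i) ** x ** outer (w j) (w j) \<in> S"
        using sub x e ij unfolding subalgebra_def by blast
      then have "mat (inverse (entry w x i j)) ** (mat (entry w x i j) ** outer (w i) (w j)) \<in> S"
        using sub unfolding subalgebra_def outer_sandwich[of w] by blast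
      then have "outer (w i) (w j) \<in> S" using c by (simp add: matrix_mul_assoc mat_mult_mat)
      moreover have "outer (w j) (w i) \<in> S" using e ij by auto
      ultimately have "outer (w i) (w j) \<in> ?D" unfolding SD[symmetric] Int_iff adj_iff by simp
      then have "entry w (outer (w i) (w j)) i j = 0" using ij by auto
      then show False using ij by (simp add: entry_unit[OF w])
    qed
    then show ?thesis using S(2) unfolding nest_alg_atom_list by blast
  qed
  ultimately show ?thesis using assms unfolding maximal_triangular_subalgebra_def by blast
qed

text \<open>A partial permutation matrix times a scalar of modulus one, with its nonzero entries at
  the positions \<open>(g s, h s)\<close>. Injectivity makes it a partial isometry,
  \<open>le\<close> makes it triangular, and \<open>oc\<close> keeps any entry from lying strictly
  above and to the right of another.\<close>

lemma Pisom_oc_atom_list_sum: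
  assumes S: "inj_on g S" "inj_on h S" "finite S"
    and I: "\<And>s. s \<in> S \<Longrightarrow> g s \<in> I" "\<And>s. s \<in> S \<Longrightarrow> h s \<in> I"
    and le: "\<And>s. s \<in> S \<Longrightarrow> g s \<le> h s"
    and oc: "\<And>s s'. s \<in> S \<Longrightarrow> s' \<in> S \<Longrightarrow> g s < g s' \<Longrightarrow> h s \<le> h s'"
    and c: "cnj c * c = 1"
  shows "mat c ** (\<Sum>s\<in>S. outer (w (g s)) (w (h s))) \<in> Pisom_oc (atom_list I w)"
proof -
  let ?v = "mat c ** (\<Sum>s\<in>S. outer (w (g s)) (w (h s)))"
  have ent: "entry w ?v i j = (if \<exists>s\<in>S. g s = i \<and> h s = j then c else 0)" if "i \<in> I" "j \<in> I" for i j
  proof (cases "\<exists>s\<in>S. g s = i \<and> h s = j")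
    case True
    then obtain s where s: "s \<in> S" "g s = i" "h s = j" by blast
    have "entry w ?v i j = c * (\<Sum>t\<in>S. if t = s then 1 else 0)"
      unfolding entry_scale entry_sum
      by (intro arg_cong[of _ _ "\<lambda>z. c * z"] sum.cong refl, subst entry_unit[OF w])
         (use that s I S in \<open>auto dest: inj_onD\<close>)
    then show ?thesis using S(3) s by auto
  next
    case False
    then show ?thesis
      unfolding entry_scale entry_sum using that I
      by (auto simp: entry_unit[OF w] intro!: sum.neutral)
  qed
  have "?v \<in> nest_alg (atom_list I w)"
    using le by (auto simp: nest_alg_atom_list ent)
  moreover have "partial_isometry ?v"
  proof -
    let ?p = "\<Sum>s\<in>S. outer (w (h s)) (w (h s))"
    \<comment> \<open>With \<open>k = g\<close> this computes \<open>adj ?v ** ?v\<close>, with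
      \<open>k = h\<close> it shows that \<open>?p\<close> is idempotent.\<close>
    have mult: "(\<Sum>s\<in>S. outer (w (h s)) (w (k s))) ** (\<Sum>s\<in>S. outer (w (k s)) (w (h s))) = ?p"
      if "inj_on k S" "\<And>s. s \<in> S \<Longrightarrow> k s \<in> I" for k
    proof -
      have "(\<Sum>s\<in>S. outer (w (h s)) (w (k s))) ** (\<Sum>s\<in>S. outer (w (k s)) (w (h s)))
        = (\<Sum>s\<in>S. \<Sum>t\<in>S. if t = s then outer (w (h s)) (w (h s)) else 0)"
        unfolding matrix_sum_mult_left matrix_sum_mult_right outer_mult_outer
        by (intro sum.cong refl) (use that in \<open>auto simp: basis_cinner[OF w] dest: inj_onD\<close>)
      then show ?thesis using S(3) by simp
    qed
    have "adj ?v ** ?v = (\<Sum>s\<in>S. outer (w (h s)) (w (g s))) ** (mat (cnj c) ** mat c) ** (\<Sum>s\<in>S. outer (w (g s)) (w (h s)))"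
      by (simp add: adj_mult adj_sum matrix_mul_assoc)
    also have "\<dots> = ?p" using mult[OF S(1) I(1)] by (simp add: mat_mult_mat c)
    finally show ?thesis
      using mult[OF S(2) I(2)] by (simp add: partial_isometry_def projection_def adj_sum)
  qed
  moreover have "partial_isometry (mat (entry w ?v i j) ** outer (w i) (w j))" if "i \<in> I" "j \<in> I" for i j
  proof -
    have "adj (mat c ** outer (w i) (w j)) ** (mat c ** outer (w i) (w j))
      = outer (w j) (w i) ** (mat (cnj c) ** mat c) ** outer (w i) (w j)"
      by (simp add: adj_mult matrix_mul_assoc)
    also have "\<dots> = outer (w j) (w j)"
      using that by (simp add: mat_mult_mat c outer_mult_outer basis_cinner[OF w])
    finally show ?thesis
      using that by (simp add: ent partial_isometry_def projection_outer basis_cinner[OF w])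
  qed
  ultimately have "?v \<in> Pisom_reg (atom_list I w)"
    by (simp add: Pisom_reg_def atom_list_nth outer_sandwich[of w] ix_mem)
  moreover have "entry w ?v (ix p) (ix p') = 0 \<or> entry w ?v (ix s) (ix t) = 0"
    if "p < card I" "p' < card I" "s < p" "p' < t" "t < card I" for p p' s t
  proof (rule ccontr)
    assume "\<not> ?thesis"
    then have "\<exists>a\<in>S. g a = ix p \<and> h a = ix p'" "\<exists>a\<in>S. g a = ix s \<and> h a = ix t"
      using that by (auto simp: ent ix_mem split: if_splits)
    then obtain a b where ab: "a \<in> S" "g a = ix p" "h a = ix p'" "b \<in> S" "g b = ix s" "h b = ix t"
      by blast
    have "ix s < ix p" using ix_less[of s p] that(1,3) by simp
    moreover have "ix p' < ix t" using ix_less[of p' t] that(2,4,5) by simp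
    ultimately show False using oc[OF ab(4) ab(1)] ab(2,3,5,6) by (metis leD)
  qed
  ultimately show ?thesis
    unfolding Pisom_oc_def mem_Collect_eq length_atom_list
    by (auto simp: atom_list_nth outer_sandwich[of w] mat_nonzero_mult_eq_0_iff)
qed

text \<open>All blocks are one by one here, so regularity makes the squared modulus of each entry
  \<open>0\<close> or \<open>1\<close>. By Parseval these sum to
  \<open>cinner x x * cinner y y\<close>, which is \<open>1\<close> for a rank one partial isometry
  \<open>outer x y\<close>; so a single entry is nonzero.\<close>

lemma Pisom_reg_rank_1:
  assumes v: "v \<in> Pisom_reg (atom_list I w)" "rank v = 1"
  shows "\<exists>c i j. i \<in> I \<and> j \<in> I \<and> i \<le> j \<and> cnj c * c = 1 \<and> v = mat c ** outer (w i) (w j)"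
proof -
  let ?e = "entry w v"
  obtain x y where xy: "v = outer x y" using rank_1_imp_outer[OF v(2)] by blast
  have nz: "outer y y \<noteq> 0" "x \<noteq> 0"
  proof -
    have "rank (0 :: complex^'n^'n) \<le> card ({} :: (complex^'n) set)"
      unfolding row_rank_def_gen by (rule vec.dim_le_card) (auto simp: rows_def row_def vec_eq_iff)
    then have "v \<noteq> 0" using v(2) by auto
    then show "outer y y \<noteq> 0" "x \<noteq> 0" by (auto simp: xy outer_eq_0_iff)
  qed
  \<comment> \<open>Idempotence says \<open>z * z * cinner b b = z\<close>. This serves both
    \<open>v\<close> itself and its single entries.\<close>
  have scaled_projection: "z = 0 \<or> z * cinner b b = 1"
    if "projection (mat z ** outer b b)" "outer b b \<noteq> 0" for z and b :: "complex^'n"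
  proof -
    have "mat z ** outer b b ** (mat z ** outer b b) = mat (z * z * cinner b b) ** outer b b"
      by (simp add: matrix_eq matrix_vector_mul_assoc[symmetric] mult_ac vector_scalar_commute)
    with that(1) have "mat (z * z * cinner b b - z) ** outer b b = 0"
      by (simp add: projection_def matrix_eq matrix_vector_mul_assoc[symmetric] algebra_simps)
    then have "z * z * cinner b b - z = 0" using that(2) by (simp add: mat_nonzero_mult_eq_0_iff)
    then have "z * (z * cinner b b - 1) = 0" by (simp add: algebra_simps)
    then show ?thesis by auto
  qed
  have ev: "cnj (?e i j) * ?e i j = 0 \<or> cnj (?e i j) * ?e i j = 1" if ij: "i \<in> I" "j \<in> I" for i j
  proof -
    obtain p p' where p: "p < card I" "p' < card I" "ix p = i" "ix p' = j"
      using ix_ex[OF ij(1)] ix_ex[OF ij(2)] by blast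
    have "partial_isometry (mat (?e i j) ** outer (w i) (w j))"
      using v(1) p unfolding Pisom_reg_def by (auto simp: atom_list_nth outer_sandwich[of w])
    moreover have "adj (mat (?e i j) ** outer (w i) (w j)) ** (mat (?e i j) ** outer (w i) (w j))
      = mat (cnj (?e i j) * ?e i j) ** outer (w j) (w j)"
      using that by (simp add: matrix_eq matrix_vector_mul_assoc[symmetric] adj_mult basis_cinner[OF w] mult_ac)
    ultimately show ?thesis
      using scaled_projection[of "cnj (?e i j) * ?e i j" "w j"] that
      by (simp add: partial_isometry_def outer_eq_0_iff basis_nonzero[OF w] basis_cinner[OF w])
  qed
  have parseval: "(\<Sum>i\<in>I. cnj (cinner (w i) z) * cinner (w i) z) = cinner z z" for z
  proof -
    have "cinner z z = cinner z (\<Sum>i\<in>I. cinner (w i) z *s w i)"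
      by (rule arg_cong[OF basis_expand_vec[OF w]])
    also have "\<dots> = (\<Sum>i\<in>I. cinner (w i) z * cinner z (w i))" by (simp add: cinner_sum_right)
    finally show ?thesis by (simp add: cinner_commute[of z "w i" for i] mult.commute)
  qed
  have "projection (mat (cinner x x) ** outer y y)"
    using v(1) by (simp add: Pisom_reg_def partial_isometry_def xy outer_mult_outer)
  then have norm1: "cinner x x * cinner y y = 1" using scaled_projection nz by fastforce
  have "cinner x x * cinner y y
    = (\<Sum>i\<in>I. \<Sum>j\<in>I. cnj (cinner (w i) x) * cinner (w i) x * (cnj (cinner (w j) y) * cinner (w j) y))"
    by (simp only: parseval[symmetric] sum_product)
  also have "\<dots> = (\<Sum>i\<in>I. \<Sum>j\<in>I. cnj (?e i j) * ?e i j)"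
    by (simp add: xy entry_outer cinner_commute[of y "w i" for i] mult_ac)
  also have "\<dots> = (\<Sum>(i,j)\<in>I \<times> I. if ?e i j \<noteq> 0 then 1 else 0)"
    unfolding sum.cartesian_product
  proof (intro sum.cong refl, clarify)
    fix i j assume "i \<in> I" "j \<in> I"
    from ev[OF this] show "cnj (?e i j) * ?e i j = (if ?e i j \<noteq> 0 then 1 else 0)" by auto
  qed
  also have "\<dots> = of_nat (card {(i,j)\<in>I \<times> I. ?e i j \<noteq> 0})"
  proof -
    have "(\<Sum>p\<in>I \<times> I. if ?e (fst p) (snd p) \<noteq> 0 then 1 else 0 :: complex)
      = (\<Sum>p\<in>{p\<in>I \<times> I. ?e (fst p) (snd p) \<noteq> 0}. 1)"
      using fin by (subst sum.inter_filter[symmetric]) auto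
    moreover have "{p\<in>I \<times> I. ?e (fst p) (snd p) \<noteq> 0} = {(i,j)\<in>I \<times> I. ?e i j \<noteq> 0}" by auto
    ultimately show ?thesis by (simp add: case_prod_beta)
  qed
  finally have "card {(i,j)\<in>I \<times> I. ?e i j \<noteq> 0} = 1" by (simp only: norm1) simp
  then obtain p where p: "{(i,j)\<in>I \<times> I. ?e i j \<noteq> 0} = {p}" by (rule card_1_singletonE)
  obtain i j where ij: "p = (i, j)" by fastforce
  have I: "i \<in> I" "j \<in> I" "?e i j \<noteq> 0" using p ij by blast+
  have other: "?e i' j' = 0" if "i' \<in> I" "j' \<in> I" "(i', j') \<noteq> (i, j)" for i' j'
    using p ij that by blast
  have "v = mat (?e i j) ** outer (w i) (w j)"
    by (rule basis_entry_eqI[OF w]) (use I other in \<open>auto simp: entry_scale entry_unit[OF w]\<close>)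
  moreover have "i \<le> j"
    using v(1) I by (auto simp: Pisom_reg_def nest_alg_atom_list)
  moreover have "cnj (?e i j) * ?e i j = 1" using ev[OF I(1,2)] I(3) by auto
  ultimately show ?thesis using I by blast
qed

end

section \<open>Bases adapted to a nest algebra\<close>

text \<open>\<open>\<kappa> i\<close> is the position of the atom whose range contains
  \<open>w i\<close>. Its monotonicity puts the triangular algebra of the basis inside the nest
  algebra.\<close>

definition adapted_basis ::
  "(complex^'n^'n) list \<Rightarrow> 'k::linorder set \<Rightarrow> ('k \<Rightarrow> complex^'n) \<Rightarrow> ('k \<Rightarrow> nat) \<Rightarrow> bool" where
  "adapted_basis q I w \<kappa> \<longleftrightarrow> ordered_decomposition q \<and> orthonormal_basis I w \<and>
     (\<forall>i\<in>I. \<kappa> i < length q \<and> q ! \<kappa> i *v w i = w i) \<and> (\<forall>i\<in>I. \<forall>j\<in>I. i \<le> j \<longrightarrow> \<kappa> i \<le> \<kappa> j)"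

context
  fixes q :: "(complex^'n^'n) list" and I :: "'k::linorder set" and w \<kappa>
  assumes ad: "adapted_basis q I w \<kappa>"
begin

private lemma q: "ordered_decomposition q" and w: "orthonormal_basis I w"
  using ad by (auto simp: adapted_basis_def)

lemma adapted_basis_mono: "i \<in> I \<Longrightarrow> j \<in> I \<Longrightarrow> i \<le> j \<Longrightarrow> \<kappa> i \<le> \<kappa> j"
  and adapted_basis_less: "i \<in> I \<Longrightarrow> \<kappa> i < length q"
  using ad by (auto simp: adapted_basis_def)

lemma adapted_basis_atom_vec:
  assumes "i \<in> I" "k < length q"
  shows "q ! k *v w i = (if k = \<kappa> i then w i else 0)"
proof -
  have "q ! k *v (q ! \<kappa> i *v w i) = (if k = \<kappa> i then q ! k *v w i else 0)"
    using ordered_decomposition_mult_vec[OF q, of k "\<kappa> i"] assms adapted_basis_less by simp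
  then show ?thesis using ad assms by (auto simp: adapted_basis_def split: if_splits)
qed

lemma adapted_basis_atom:
  assumes "k < length q"
  shows "q ! k = (\<Sum>i\<in>{i\<in>I. \<kappa> i = k}. outer (w i) (w i))"
proof -
  have "q ! k = q ! k ** (\<Sum>i\<in>I. outer (w i) (w i))" by (simp add: basis_sum[OF w])
  also have "\<dots> = (\<Sum>i\<in>I. if \<kappa> i = k then outer (w i) (w i) else 0)"
    unfolding matrix_sum_mult_right mult_outer
    by (intro sum.cong refl) (use assms in \<open>auto simp: adapted_basis_atom_vec\<close>)
  finally show ?thesis using basis_finite[OF w] by (simp add: sum.inter_filter)
qed

lemma adapted_basis_sandwich:
  assumes "i \<in> I" "j \<in> I" "s < length q" "t < length q"
  shows "q ! s ** outer (w i) (w j) ** q ! t = (if \<kappa> i = s \<and> \<kappa> j = t then outer (w i) (w j) else 0)"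
  using assms ordered_decomposition_projection[OF q]
  by (auto simp: mult_outer outer_mult adapted_basis_atom_vec projection_def)

lemma adapted_basis_nest_alg: "nest_alg (atom_list I w) \<subseteq> nest_alg q"
proof
  fix x assume x: "x \<in> nest_alg (atom_list I w)"
  have "q ! s ** x ** q ! t = 0" if st: "s < length q" "t < s" for s t
  proof -
    have "q ! s ** x ** q ! t = (\<Sum>j\<in>{j\<in>I. \<kappa> j = t}. \<Sum>i\<in>{i\<in>I. \<kappa> i = s}.
        mat (entry w x i j) ** outer (w i) (w j))"
      using st by (simp only: adapted_basis_atom less_trans[OF st(2) st(1)] matrix_sum_mult_left
          matrix_sum_mult_right outer_sandwich[of w])
    also have "\<dots> = 0"
    proof (intro sum.neutral ballI)
      fix i j assume "i \<in> {i\<in>I. \<kappa> i = s}" "j \<in> {j\<in>I. \<kappa> j = t}"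
      then have "i \<in> I" "j \<in> I" "\<not> i \<le> j" using adapted_basis_mono[of i j] st by auto
      then show "mat (entry w x i j) ** outer (w i) (w j) = 0"
        using x by (simp add: nest_alg_atom_list[OF w] mat_nonzero_mult_eq_0_iff)
    qed
    finally show ?thesis .
  qed
  then show "x \<in> nest_alg q" by (simp add: nest_alg_iff[OF q])
qed

lemma adapted_basis_unit_nest_alg:
  assumes "i \<in> I" "j \<in> I" "\<kappa> i \<le> \<kappa> j"
  shows "outer (w i) (w j) \<in> nest_alg q"
  using assms by (auto simp: nest_alg_iff[OF q] adapted_basis_sandwich)

text \<open>No basis vector in the block would make the atom zero, and exactly one would make it
  \<open>outer (w i) (w i)\<close>, of rank one.\<close>

lemma adapted_basis_rank:
  assumes "k < length q" "rank (q ! k) \<noteq> 1"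
  obtains i j where "i \<in> I" "j \<in> I" "i \<noteq> j" "\<kappa> i = k" "\<kappa> j = k"
proof -
  have "{i\<in>I. \<kappa> i = k} \<noteq> {}"
    using adapted_basis_atom[OF assms(1)] ordered_decomposition_nonzero[OF q assms(1)]
    by (metis sum.empty)
  then obtain i where i: "i \<in> I" "\<kappa> i = k" by blast
  have "{i\<in>I. \<kappa> i = k} \<noteq> {i}"
  proof
    assume "{i\<in>I. \<kappa> i = k} = {i}"
    then have "q ! k = outer (w i) (w i)" by (simp add: adapted_basis_atom[OF assms(1)])
    then show False using assms(2) rank_outer[OF basis_nonzero[OF w i(1)] basis_nonzero[OF w i(1)]] by simp
  qed
  then show ?thesis using that i by blast
qed

end

text \<open>Orthonormal bases of the ranges of the atoms are concatenated in the order of the atoms,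
  by induction on the number \<open>m\<close> of atoms covered; different atoms contribute
  orthogonal vectors.\<close>

lemma adapted_basis_exists:
  fixes q :: "(complex^'n^'n) list"
  assumes q: "ordered_decomposition q"
  obtains N u \<beta> where "adapted_basis q {..<N::nat} u \<beta>"
proof -
  have "\<exists>(N::nat) u \<beta>. orthonormal_on {..<N} u \<and> (\<Sum>i<N. outer (u i) (u i)) = (\<Sum>k<m. q ! k) \<and>
     (\<forall>i<N. \<beta> i < m \<and> q ! \<beta> i *v u i = u i) \<and> (\<forall>i<N. \<forall>j<N. i \<le> j \<longrightarrow> \<beta> i \<le> \<beta> j)"
    if "m \<le> length q" for m
    using that
  proof (induction m)
    case 0
    then show ?case by (intro exI[of _ 0]) (auto simp: orthonormal_on_def)
  next
    case (Suc m)
    then obtain N :: nat and u :: "nat \<Rightarrow> complex^'n" and \<beta> :: "nat \<Rightarrow> nat" where u: "orthonormal_on {..<N} u" "(\<Sum>i<N. outer (u i) (u i)) = (\<Sum>k<m. q ! k)"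
      and u': "\<forall>i<N. \<beta> i < m \<and> q ! \<beta> i *v u i = u i" "\<forall>i<N. \<forall>j<N. i \<le> j \<longrightarrow> \<beta> i \<le> \<beta> j"
      using Suc_leD by blast
    have m: "m < length q" using Suc.prems by simp
    obtain d v where v: "orthonormal_on {..<d::nat} v" "q ! m = (\<Sum>s<d. outer (v s) (v s))"
      using projection_decomposition[OF ordered_decomposition_projection[OF q m]] by blast
    have qv: "q ! m *v v s = v s" if "s < d" for s
      unfolding v(2) by (rule outer_sum_fixes[OF v(1)]) (use that in simp)
    have uv: "cinner (u i) (v s) = 0" if "i < N" "s < d" for i s
    proof -
      have l: "\<beta> i < length q" "\<beta> i \<noteq> m" using u'(1) that(1) m by auto
      have "cinner (u i) (v s) = cinner (q ! \<beta> i *v u i) (q ! m *v v s)"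
        using that by (simp add: u' qv)
      also have "\<dots> = cinner (u i) (q ! \<beta> i *v (q ! m *v v s))"
        by (rule projection_cinner) (rule ordered_decomposition_projection[OF q l(1)])
      also have "\<dots> = 0" using ordered_decomposition_mult_vec[OF q l(1) m] l(2) by simp
      finally show ?thesis .
    qed
    have vu: "cinner (v s) (u i) = 0" if "i < N" "s < d" for i s
      using uv[OF that] cinner_commute[of "v s" "u i"] by simp
    have split: "(\<Sum>i<N + d. f i) = (\<Sum>i<N. f i) + (\<Sum>s<d. f (N + s))"
      for f :: "nat \<Rightarrow> complex^'n^'n"
      by (induction d) (simp_all add: add.assoc)
    let ?u = "\<lambda>i. if i < N then u i else v (i - N)" and ?\<beta> = "\<lambda>i. if i < N then \<beta> i else m"
    have "orthonormal_on {..<N + d} ?u"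
      unfolding orthonormal_on_def
    proof (intro conjI ballI)
      fix i j assume "i \<in> {..<N + d}" "j \<in> {..<N + d}"
      then show "cinner (?u i) (?u j) = (if i = j then 1 else 0)"
        using orthonormal_onD[OF u(1), of i j] orthonormal_onD[OF v(1), of "i - N" "j - N"]
          uv[of i "j - N"] vu[of j "i - N"] by (auto simp: not_less less_diff_conv2)
    qed simp
    moreover have "(\<Sum>i<N + d. outer (?u i) (?u i)) = (\<Sum>k<Suc m. q ! k)"
      using u(2) v(2) by (simp add: split)
    moreover have "\<forall>i<N + d. ?\<beta> i < Suc m \<and> q ! ?\<beta> i *v ?u i = ?u i"
      using u'(1) qv by (auto simp: less_Suc_eq)
    moreover have "\<forall>i<N + d. \<forall>j<N + d. i \<le> j \<longrightarrow> ?\<beta> i \<le> ?\<beta> j"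
      using u' less_imp_le by auto
    ultimately show ?case by (intro exI[of _ "N + d"] exI[of _ ?u] exI[of _ ?\<beta>] conjI)
  qed
  from this[of "length q", OF order_refl] obtain N :: nat and u \<beta> where
    "orthonormal_on {..<N} u" "(\<Sum>i<N. outer (u i) (u i)) = (\<Sum>k<length q. q ! k)"
    "\<forall>i<N. \<beta> i < length q \<and> q ! \<beta> i *v u i = u i" "\<forall>i<N. \<forall>j<N. i \<le> j \<longrightarrow> \<beta> i \<le> \<beta> j"
    by blast
  then have "adapted_basis q {..<N} u \<beta>"
    using q by (simp add: adapted_basis_def orthonormal_basis_def ordered_decomposition_sum)
  then show ?thesis by (rule that)
qed

section \<open>The multiplicity space of an order conserving representation\<close>

lemma matrix_mult_vec_swap: "a ** b = c ** d \<Longrightarrow> a *v (b *v x) = c *v (d *v x)"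
  for a b c d :: "complex^'n^'n"
  by (simp add: matrix_vector_mul_assoc)

context
  fixes \<Phi> :: "complex^'n^'n \<Rightarrow> complex^'m^'m"
  assumes hom: "star_hom \<Phi>"
begin

lemma star_hom_add: "\<Phi> (a + b) = \<Phi> a + \<Phi> b"
  and star_hom_scale: "\<Phi> (mat c ** a) = mat c ** \<Phi> a"
  and star_hom_mult: "\<Phi> (a ** b) = \<Phi> a ** \<Phi> b"
  and star_hom_adj: "\<Phi> (adj a) = adj (\<Phi> a)"
  using hom unfolding star_hom_def by blast+

lemma star_hom_0: "\<Phi> 0 = 0"
  using star_hom_add[of 0 0] by simp

lemma star_hom_sum: "\<Phi> (\<Sum>i\<in>I. f i) = (\<Sum>i\<in>I. \<Phi> (f i))"
  by (induction I rule: infinite_finite_induct) (auto simp: star_hom_add star_hom_0)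

lemma star_hom_diff: "\<Phi> (a - b) = \<Phi> a - \<Phi> b"
  using star_hom_add[of "a - b" b] by (simp add: algebra_simps)

end

section \<open>Comparison of two monotone functions\<close>

text \<open>\<open>cross\<close> makes the functions comparable, say \<open>f \<le> g\<close>. If
  \<open>g 0 < f (l - 1)\<close>, then \<open>gap\<close> at the two ends gives equal first values
  and equal last values. Where the functions differ, \<open>gap\<close> forces \<open>f\<close> to
  its first and \<open>g\<close> to its last value.\<close>

lemma monotone_chain_dichotomy:
  fixes f g :: "nat \<Rightarrow> nat"
  assumes l: "0 < l"
    and mono: "\<And>i j. i < j \<Longrightarrow> j < l \<Longrightarrow> f i \<le> f j" "\<And>i j. i < j \<Longrightarrow> j < l \<Longrightarrow> g i \<le> g j"
    and cross: "\<And>i j. i < j \<Longrightarrow> j < l \<Longrightarrow> \<not> (g i < f i \<and> f j < g j)"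
      "\<And>i j. i < j \<Longrightarrow> j < l \<Longrightarrow> \<not> (f i < g i \<and> g j < f j)"
    and gap: "\<And>i j d. i < j \<Longrightarrow> j < l \<Longrightarrow> d \<in> {i, j} \<Longrightarrow> \<not> (f i < g d \<and> g d < f j)"
      "\<And>i j d. i < j \<Longrightarrow> j < l \<Longrightarrow> d \<in> {i, j} \<Longrightarrow> \<not> (g i < f d \<and> f d < g j)"
  shows "f (l - 1) \<le> g 0 \<or> g (l - 1) \<le> f 0 \<or>
    f 0 = g 0 \<and> f (l - 1) = g (l - 1) \<and>
    ((\<forall>i<l. f i = g i) \<or> (\<forall>i<l. f i \<in> {f 0, f (l - 1)}))"
proof -
  \<comment> \<open>Stated for fresh functions, so that the second use can exchange their roles; for
    that use the last alternative constrains the values of both.\<close>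
  have le: "f (l - 1) \<le> g 0 \<or> f 0 = g 0 \<and> f (l - 1) = g (l - 1) \<and>
      ((\<forall>i<l. f i = g i) \<or> (\<forall>i<l. f i \<in> {f 0, f (l - 1)} \<and> g i \<in> {f 0, f (l - 1)}))"
    if fg: "\<And>i. i < l \<Longrightarrow> f i \<le> g i"
      and mono: "\<And>i j. i < j \<Longrightarrow> j < l \<Longrightarrow> f i \<le> f j" "\<And>i j. i < j \<Longrightarrow> j < l \<Longrightarrow> g i \<le> g j"
      and gap: "\<And>i j d. i < j \<Longrightarrow> j < l \<Longrightarrow> d \<in> {i, j} \<Longrightarrow> \<not> (f i < g d \<and> g d < f j)"
        "\<And>i j d. i < j \<Longrightarrow> j < l \<Longrightarrow> d \<in> {i, j} \<Longrightarrow> \<not> (g i < f d \<and> f d < g j)"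
    for f g :: "nat \<Rightarrow> nat"
  proof (cases "f (l - 1) \<le> g 0")
    case True
    then show ?thesis ..
  next
    case ov: False
    show ?thesis
    proof (cases "l = 1")
      case True
      then show ?thesis using ov fg[of 0] by auto
    next
      case False
      then have l1: "0 < l - 1" "l - 1 < l" using l by auto
      have fst: "f 0 = g 0" using gap(1)[OF l1, of 0] ov fg[of 0] l by auto
      have lst: "f (l - 1) = g (l - 1)" using gap(2)[OF l1, of "l - 1"] ov fg[of "l - 1"] l1 by auto
      have diff: "f i = f 0 \<and> g i = f (l - 1)" if i: "i < l" "f i \<noteq> g i" for i
      proof -
        have i': "0 < i" "i < l - 1" using i fst lst l
          by (metis not_gr_zero, metis One_nat_def Suc_pred less_SucE)
        have lt: "f i < g i" using fg[OF i(1)] i(2) by simp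
        have "g i \<le> f (l - 1)" using mono(2)[OF i'(2) l1(2)] lst by simp
        moreover have "\<not> g i < f (l - 1)" using gap(1)[OF i'(2) l1(2), of i] lt by auto
        moreover have "f 0 \<le> f i" using mono(1)[OF i'(1) i(1)] .
        moreover have "\<not> f 0 < f i" using gap(2)[OF i'(1) i(1), of i] lt fst by auto
        ultimately show ?thesis by auto
      qed
      \<comment> \<open>A common value before a place \<open>j\<close> of disagreement is squeezed
        between \<open>f 0\<close> and \<open>f j\<close>, one after \<open>j\<close> between
        \<open>g j\<close> and \<open>g (l - 1)\<close>; in both cases the two bounds are
        equal.\<close>
      have "f i \<in> {f 0, f (l - 1)} \<and> g i \<in> {f 0, f (l - 1)}"
        if j: "j < l" "f j \<noteq> g j" and i: "i < l" for i j
      proof (cases "f i = g i")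
        case False
        then show ?thesis using diff[OF i] by auto
      next
        case True
        then have "i \<noteq> j" using j by auto
        then consider "i < j" | "j < i" by linarith
        then show ?thesis
        proof cases
          case 1
          have "f 0 \<le> f i" using mono(1)[of 0 i] i by (cases "i = 0") auto
          moreover have "f i \<le> f j" using mono(1) 1 j by simp
          ultimately show ?thesis using diff[OF j] True by auto
        next
          case 2
          have "g i \<le> g (l - 1)" using mono(2)[of i "l - 1"] i l1 by (cases "i = l - 1") auto
          moreover have "g j \<le> g i" using mono(2) 2 i by simp
          ultimately show ?thesis using diff[OF j] True lst by auto
        qed
      qed
      then show ?thesis using fst lst by blast
    qed
  qed
  have "(\<forall>i<l. f i \<le> g i) \<or> (\<forall>i<l. g i \<le> f i)"
  proof (rule ccontr)
    assume "\<not> ?thesis"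
    then obtain i j where ij: "i < l" "g i < f i" "j < l" "f j < g j" by (auto simp: not_le)
    then have "i \<noteq> j" by auto
    then show False using cross(1)[of i j] cross(2)[of j i] ij by (meson linorder_neqE_nat)
  qed
  then show ?thesis
  proof
    assume "\<forall>i<l. f i \<le> g i"
    then have "f i \<le> g i" if "i < l" for i using that by blast
    from le[of f g, OF this mono gap] show ?thesis by blast
  next
    assume "\<forall>i<l. g i \<le> f i"
    then have "g i \<le> f i" if "i < l" for i using that by blast
    from le[of g f, OF this mono(2,1) gap(2,1)]
    have "g (l - 1) \<le> f 0 \<or> g 0 = f 0 \<and> g (l - 1) = f (l - 1) \<and> ((\<forall>i<l. g i = f i) \<or>
      (\<forall>i<l. g i \<in> {g 0, g (l - 1)} \<and> f i \<in> {g 0, g (l - 1)}))" by blast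
    then show ?thesis by (elim disjE conjE) simp_all
  qed
qed

lemma Pisom_oc_block:
  "v \<in> Pisom_oc r \<Longrightarrow> i < length r \<Longrightarrow> j < length r \<Longrightarrow> partial_isometry (r ! i ** v ** r ! j)"
  unfolding Pisom_oc_def Pisom_reg_def mem_Collect_eq by (elim conjE) iprover

lemma Pisom_oc_order:
  assumes "v \<in> Pisom_oc r" "r ! i ** v ** r ! j \<noteq> 0" "i < length r" "s < i" "j < t" "t < length r"
  shows "r ! s ** v ** r ! t = 0"
proof -
  have "j < length r" using assms(5,6) by simp
  from assms(1)[unfolded Pisom_oc_def mem_Collect_eq, THEN conjunct2, rule_format,
      OF assms(3) this assms(2,4) conjI[OF assms(5,6)]]
  show ?thesis .
qed

section \<open>The representation and its matrix units\<close>

text \<open>\<open>\<Phi>\<close> is the star extension of the embedding; the basis vector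
  \<open>u i\<close> lies in the block \<open>\<beta> i\<close> of the first algebra.\<close>

locale order_conserving_rep =
  fixes q :: "(complex^'n^'n) list" and r :: "(complex^'m^'m) list"
    and \<Phi> :: "complex^'n^'n \<Rightarrow> complex^'m^'m"
    and N :: nat and u :: "nat \<Rightarrow> complex^'n" and \<beta> :: "nat \<Rightarrow> nat"
  assumes u: "adapted_basis q {..<N} u \<beta>"
    and r: "ordered_decomposition r"
    and hom: "star_hom \<Phi>"
    and nest: "x \<in> nest_alg q \<Longrightarrow> \<Phi> x \<in> nest_alg r"
    and oc: "v \<in> Pisom_oc q \<Longrightarrow> \<Phi> v \<in> Pisom_oc r"
    and rank: "x \<in> set q \<Longrightarrow> rank x \<noteq> 1"
begin

lemma q: "ordered_decomposition q" and basis: "orthonormal_basis {..<N} u"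
  using u by (auto simp: adapted_basis_def)

lemma block_less: "i < N \<Longrightarrow> \<beta> i < length q"
  using adapted_basis_less[OF u] by simp

lemma block_ex2: "k < length q \<Longrightarrow> \<exists>i<N. \<exists>j<N. i \<noteq> j \<and> \<beta> i = k \<and> \<beta> j = k"
  using adapted_basis_rank[OF u, of k] rank by (metis lessThan_iff nth_mem)

text \<open>In the notation of the introduction, the matrix unit at \<open>(i, j)\<close> tensored
  with \<open>1\<close>.\<close>

definition G :: "nat \<Rightarrow> nat \<Rightarrow> complex^'m^'m" where
  "G i j = \<Phi> (outer (u i) (u j))"

abbreviation E :: "complex^'m^'m" where
  "E \<equiv> \<Phi> (mat 1)"

lemma G_mult: "i < N \<Longrightarrow> j < N \<Longrightarrow> k < N \<Longrightarrow> m < N \<Longrightarrow>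
    G i j ** G k m = (if j = k then G i m else 0)"
  by (auto simp: G_def star_hom_mult[OF hom, symmetric] outer_mult_outer basis_cinner[OF basis]
      star_hom_0[OF hom])

lemma G_mult_vec: "i < N \<Longrightarrow> j < N \<Longrightarrow> k < N \<Longrightarrow> m < N \<Longrightarrow>
    G i j *v (G k m *v x) = (if j = k then G i m *v x else 0)"
  by (simp add: matrix_vector_mul_assoc G_mult)

lemma G_adj: "adj (G i j) = G j i"
  by (simp add: G_def star_hom_adj[OF hom, symmetric])

lemma G_sum: "(\<Sum>i<N. G i i) = E"
  by (simp add: G_def star_hom_sum[OF hom, symmetric] basis_sum[OF basis])

lemma E_mult: "E ** \<Phi> x = \<Phi> x" "\<Phi> x ** E = \<Phi> x"
  by (simp_all add: star_hom_mult[OF hom, symmetric])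

lemma star_hom_expand: "\<Phi> x = (\<Sum>i<N. \<Sum>j<N. mat (entry u x i j) ** G i j)"
  by (subst basis_expand_matrix[OF basis, of x])
     (simp add: star_hom_sum[OF hom] star_hom_scale[OF hom] G_def)

section \<open>Operators on the multiplicity space\<close>

text \<open>These are the operators \<open>1 \<otimes> x\<close> with \<open>x\<close> acting on the
  multiplicity space, extended by zero off the range of \<open>E\<close>.\<close>

definition commutant :: "(complex^'m^'m) set" where
  "commutant = {x. (\<forall>i<N. \<forall>j<N. x ** G i j = G i j ** x) \<and> x ** E = x}"

lemma commutant_G: "x \<in> commutant \<Longrightarrow> i < N \<Longrightarrow> j < N \<Longrightarrow> x ** G i j = G i j ** x"
  and commutant_E: "x \<in> commutant \<Longrightarrow> x ** E = x"
  by (auto simp: commutant_def)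

lemma commutant_star_hom:
  assumes "x \<in> commutant"
  shows "x ** \<Phi> y = \<Phi> y ** x"
proof -
  have "x ** (mat c ** G i j) = mat c ** G i j ** x" if "i < N" "j < N" for c i j
    using commutant_G[OF assms that] by (metis mat_mult_commute matrix_mul_assoc)
  then show ?thesis
    by (simp add: star_hom_expand[of y] matrix_sum_mult_left matrix_sum_mult_right)
qed

lemma commutant_mult: "x \<in> commutant \<Longrightarrow> y \<in> commutant \<Longrightarrow> x ** y \<in> commutant"
  unfolding commutant_def mem_Collect_eq by (metis matrix_mul_assoc)

lemma commutant_zero: "0 \<in> commutant"
  by (simp add: commutant_def)

text \<open>An operator \<open>1 \<otimes> x\<close> is determined by any one of its diagonal
  corners: \<open>G j i\<close> and \<open>G i j\<close> carry the corner at \<open>i\<close> to the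
  corner at \<open>j\<close>, and the corners sum to the operator.\<close>

lemma commutant_eqI:
  assumes xy: "x \<in> commutant" "y \<in> commutant" and i: "i < N" "x ** G i i = y ** G i i"
  shows "x = y"
proof -
  have "x ** G j j = y ** G j j" if j: "j < N" for j
  proof -
    have eq: "z ** G j j = G j i ** (z ** G i i) ** G i j" if "z \<in> commutant" for z
    proof -
      have "z ** G j j = z ** G j i ** G i i ** G i j" using i j by (simp add: G_mult matrix_mul_assoc[symmetric])
      then show ?thesis using commutant_G[OF that j i(1)] by (simp add: matrix_mul_assoc)
    qed
    show ?thesis using eq xy i(2) by simp
  qed
  then have "x ** (\<Sum>j<N. G j j) = y ** (\<Sum>j<N. G j j)" by (simp add: matrix_sum_mult_right)
  then show ?thesis using xy by (simp add: G_sum commutant_E)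
qed

lemma commutant_mult_G_eq_0:
  assumes "x \<in> commutant" "i < N" "j < N" "x ** G i j = 0"
  shows "x = 0"
proof -
  have "x ** G i i = x ** (G i j ** G j i)" using assms by (simp add: G_mult)
  also have "\<dots> = x ** G i j ** G j i" by (simp add: matrix_mul_assoc)
  finally have "x ** G i i = 0 ** G i i" using assms by simp
  then show ?thesis using commutant_eqI[OF assms(1) commutant_zero assms(2)] by simp
qed

text \<open>Matrix units inside one block lie in the first algebra together with their adjoints, so
  their images lie in the diagonal of the second algebra.\<close>

lemma atom_G_commute:
  assumes "i < N" "j < N" "\<beta> i = \<beta> j" "s < length r"
  shows "r ! s ** G i j = G i j ** r ! s"
proof (rule nest_alg_diagonal_commute[OF r])
  show "G i j \<in> nest_alg r" "adj (G i j) \<in> nest_alg r"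
    using assms by (auto simp: G_adj) (auto simp: G_def intro!: nest adapted_basis_unit_nest_alg[OF u])
qed (use assms in auto)

definition rep :: "nat \<Rightarrow> nat" where
  "rep k = (SOME i. i < N \<and> \<beta> i = k)"

lemma rep: "k < length q \<Longrightarrow> rep k < N" "k < length q \<Longrightarrow> \<beta> (rep k) = k"
  using block_ex2[of k] someI_ex[of "\<lambda>i. i < N \<and> \<beta> i = k"] unfolding rep_def by auto

text \<open>In the notation of the introduction, \<open>S k s = 1 \<otimes> R\<^sub>k\<^sub>s\<close>; any matrix unit column of the block \<open>k\<close>
  may serve as \<open>rep k\<close>.\<close>

definition S :: "nat \<Rightarrow> nat \<Rightarrow> complex^'m^'m" where
  "S k s = (\<Sum>a<N. G a (rep k) ** r ! s ** G (rep k) a)"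

text \<open>The sum repeats one corner at every index \<open>a\<close>, so multiplication by
  \<open>G i j\<close> from either side leaves the same single term.\<close>

lemma S_commutant:
  assumes k: "k < length q"
  shows "S k s \<in> commutant"
proof -
  have "S k s ** G i j = G i j ** S k s" if ij: "i < N" "j < N" for i j
  proof -
    have "S k s ** G i j = (\<Sum>a<N. if a = i then G i (rep k) ** r ! s ** G (rep k) j else 0)"
      unfolding S_def matrix_sum_mult_left
      by (rule sum.cong) (use ij rep[OF k] in \<open>auto simp: matrix_mul_assoc[symmetric] G_mult\<close>)
    also have "\<dots> = (\<Sum>a<N. if a = j then G i (rep k) ** r ! s ** G (rep k) j else 0)"
      using ij by simp
    also have "\<dots> = G i j ** S k s"
      unfolding S_def matrix_sum_mult_right
      by (rule sum.cong) (use ij rep[OF k] in \<open>auto simp: matrix_mul_assoc G_mult\<close>)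
    finally show ?thesis .
  qed
  moreover have "S k s ** E = S k s"
    by (simp add: S_def matrix_sum_mult_left matrix_mul_assoc[symmetric] G_def E_mult)
  ultimately show ?thesis by (simp add: commutant_def)
qed

lemma S_adj: "s < length r \<Longrightarrow> adj (S k s) = S k s"
  using ordered_decomposition_projection[OF r]
  by (simp add: S_def adj_sum adj_mult G_adj projection_def matrix_mul_assoc)

text \<open>On the range of \<open>G i i\<close> the atom \<open>r ! s\<close> acts through the
  multiplicity space only, in a way that depends only on the block; \<open>atom_G_commute\<close>
  carries it from the index \<open>rep (\<beta> i)\<close> to \<open>i\<close>.\<close>

lemma S_mult_G:
  assumes "i < N" "j < N" "s < length r"
  shows "S (\<beta> i) s ** G i j = r ! s ** G i j"
proof -
  let ?c = "rep (\<beta> i)"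
  have c: "?c < N" "\<beta> ?c = \<beta> i" using rep block_less[OF assms(1)] by auto
  have "S (\<beta> i) s ** G i j = (\<Sum>a<N. if a = i then G i ?c ** r ! s ** G ?c j else 0)"
    unfolding S_def matrix_sum_mult_left
    by (rule sum.cong) (use assms c in \<open>auto simp: matrix_mul_assoc[symmetric] G_mult\<close>)
  also have "\<dots> = G i ?c ** r ! s ** G ?c j" using assms by simp
  also have "\<dots> = r ! s ** (G i ?c ** G ?c j)"
    using atom_G_commute[of i ?c s] c assms by (simp add: matrix_mul_assoc)
  finally show ?thesis using assms c by (simp add: G_mult)
qed

lemma G_mult_S:
  assumes "i < N" "j < N" "s < length r"
  shows "G i j ** S (\<beta> j) s = G i j ** r ! s"
proof -
  have "adj (S (\<beta> j) s ** G j i) = adj (r ! s ** G j i)" using S_mult_G[OF assms(2,1,3)] by simp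
  then show ?thesis
    using assms(3) ordered_decomposition_projection[OF r] by (simp add: adj_mult S_adj G_adj projection_def)
qed

lemma S_mult:
  assumes k: "k < length q" and st: "s < length r" "t < length r"
  shows "S k s ** S k t = (if s = t then S k s else 0)"
proof (rule commutant_eqI)
  let ?c = "rep k"
  note c = rep[OF k]
  show "S k s ** S k t \<in> commutant" "(if s = t then S k s else 0) \<in> commutant" "?c < N"
    using S_commutant[OF k] c by (auto intro: commutant_mult commutant_zero)
  have SG: "S k z ** G ?c ?c = r ! z ** G ?c ?c" if "z < length r" for z
    using S_mult_G[OF c(1) c(1) that] c(2) by simp
  have "S k s ** S k t ** G ?c ?c = S k s ** G ?c ?c ** r ! t"
    using SG[OF st(2)] atom_G_commute[OF c(1) c(1) refl st(2)] by (simp add: matrix_mul_assoc[symmetric])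
  also have "\<dots> = r ! s ** r ! t ** G ?c ?c"
    using SG[OF st(1)] atom_G_commute[OF c(1) c(1) refl st(2)] by (simp add: matrix_mul_assoc[symmetric])
  finally show "S k s ** S k t ** G ?c ?c = (if s = t then S k s else 0) ** G ?c ?c"
    using st by (simp add: ordered_decomposition_mult[OF r] SG)
qed

lemma S_sum:
  assumes k: "k < length q"
  shows "(\<Sum>s<length r. S k s) = E"
proof -
  have "(\<Sum>s<length r. S k s) = (\<Sum>a<N. \<Sum>s<length r. G a (rep k) ** r ! s ** G (rep k) a)"
    unfolding S_def by (rule sum.swap)
  also have "\<dots> = (\<Sum>a<N. G a (rep k) ** (\<Sum>s<length r. r ! s) ** G (rep k) a)"
    by (simp only: matrix_sum_mult_left matrix_sum_mult_right)
  finally show ?thesis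
    using rep[OF k] by (simp add: ordered_decomposition_sum[OF r] G_mult G_sum)
qed

lemma S_projection: "k < length q \<Longrightarrow> s < length r \<Longrightarrow> projection (S k s)"
  by (simp add: projection_def S_mult S_adj)

text \<open>This turns conditions on the blocks of the image of a matrix unit into conditions on
  products of two projections on the multiplicity space.\<close>

lemma atom_G_atom:
  assumes "i < N" "j < N" "s < length r" "t < length r"
  shows "r ! s ** G i j ** r ! t = S (\<beta> i) s ** S (\<beta> j) t ** G i j"
proof -
  have "r ! s ** G i j ** r ! t = S (\<beta> i) s ** (G i j ** r ! t)"
    using S_mult_G[OF assms(1-3)] by (simp add: matrix_mul_assoc)
  also have "\<dots> = S (\<beta> i) s ** (S (\<beta> j) t ** G i j)"
    using G_mult_S[OF assms(1,2,4)] commutant_G[OF S_commutant[OF block_less[OF assms(2)]] assms(1,2), of t]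
    by simp
  finally show ?thesis by (simp add: matrix_mul_assoc)
qed

lemma atom_G_atom_eq_0_iff:
  assumes "i < N" "j < N" "s < length r" "t < length r"
  shows "r ! s ** G i j ** r ! t = 0 \<longleftrightarrow> S (\<beta> i) s ** S (\<beta> j) t = 0"
  unfolding atom_G_atom[OF assms]
  using commutant_mult_G_eq_0[of "S (\<beta> i) s ** S (\<beta> j) t" i j] assms
  by (auto intro!: commutant_mult S_commutant block_less)

section \<open>Consequences of regularity and order conservation\<close>

lemma unit_Pisom_oc:
  assumes "i < N" "j < N" "\<beta> i < \<beta> j"
  shows "outer (u i) (u j) \<in> Pisom_oc q"
proof -
  have "partial_isometry (outer (u i) (u j))"
    using assms by (simp add: partial_isometry_def outer_mult_outer basis_cinner[OF basis] projection_outer)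
  moreover have "partial_isometry (q ! s ** outer (u i) (u j) ** q ! t)" if "s < length q" "t < length q" for s t
    using adapted_basis_sandwich[OF u, of i j s t] assms that calculation
    by (simp add: partial_isometry_def)
  ultimately show ?thesis
    using assms adapted_basis_unit_nest_alg[OF u, of i j]
    by (auto simp: Pisom_oc_def Pisom_reg_def adapted_basis_sandwich[OF u])
qed

text \<open>The block \<open>?v\<close> of the image of a matrix unit is a partial isometry, and
  \<open>adj ?v ** ?v\<close> is the corner at \<open>rep m\<close> of the compression of
  \<open>S k s\<close> by \<open>S m t\<close>. So this compression is a projection, which forces
  commutation by \<open>projection_compression_commute\<close>.\<close>

lemma S_commute_less:
  assumes km: "k < m" "m < length q" and st: "s < length r" "t < length r"
  shows "S k s ** S m t = S m t ** S k s"
proof -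
  let ?i = "rep k" and ?j = "rep m"
  have k: "k < length q" using km by simp
  note i = rep[OF k] and j = rep[OF km(2)]
  note C = S_commutant[OF k, of s] S_commutant[OF km(2), of t]
  let ?A = "S m t ** S k s ** S m t"
  have A: "?A \<in> commutant" using C by (intro commutant_mult)
  let ?v = "r ! s ** G ?i ?j ** r ! t"
  have v: "?v = S k s ** S m t ** G ?i ?j" using atom_G_atom[OF i(1) j(1) st] i(2) j(2) by simp
  have "G ?i ?j \<in> Pisom_oc r"
    unfolding G_def using i j km by (intro oc unit_Pisom_oc) auto
  then have "partial_isometry ?v" using st by (rule Pisom_oc_block)
  moreover have "adj ?v ** ?v = ?A ** G ?j ?j"
  proof -
    have "adj ?v ** ?v = G ?j ?i ** (S m t ** (S k s ** S k s) ** S m t ** G ?i ?j)"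
      unfolding v using st by (simp add: adj_mult S_adj G_adj matrix_mul_assoc)
    also have "\<dots> = (G ?j ?i ** ?A) ** G ?i ?j" using k st by (simp add: S_mult matrix_mul_assoc)
    also have "\<dots> = ?A ** (G ?j ?i ** G ?i ?j)"
      using commutant_G[OF A j(1) i(1)] by (simp add: matrix_mul_assoc)
    finally show ?thesis using i j by (simp add: G_mult)
  qed
  ultimately have "?A ** G ?j ?j ** (?A ** G ?j ?j) = ?A ** G ?j ?j"
    by (simp add: partial_isometry_def projection_def)
  moreover have "?A ** G ?j ?j ** (?A ** G ?j ?j) = ?A ** ?A ** (G ?j ?j ** G ?j ?j)"
  proof -
    have "?A ** G ?j ?j ** (?A ** G ?j ?j) = ?A ** (G ?j ?j ** ?A) ** G ?j ?j"
      by (simp only: matrix_mul_assoc)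
    also have "\<dots> = ?A ** (?A ** G ?j ?j) ** G ?j ?j"
      by (simp only: commutant_G[OF A j(1) j(1)])
    finally show ?thesis by (simp only: matrix_mul_assoc)
  qed
  ultimately have "?A ** ?A ** G ?j ?j = ?A ** G ?j ?j" using j by (simp add: G_mult)
  then have "?A ** ?A = ?A" by (rule commutant_eqI[OF commutant_mult[OF A A] A j(1)])
  then have "projection ?A"
    using st by (simp add: projection_def adj_mult S_adj matrix_mul_assoc)
  then show ?thesis
    by (rule projection_compression_commute[OF S_projection[OF k st(1)] S_projection[OF km(2) st(2)]])
qed

lemma S_commute:
  assumes "k < length q" "m < length q" "s < length r" "t < length r"
  shows "S k s ** S m t = S m t ** S k s"
proof -
  consider "k = m" | "k < m" | "m < k" by linarith
  then show ?thesis
    using assms S_commute_less[of k m s t] S_commute_less[of m k t s] by cases (auto simp: S_mult)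
qed

text \<open>The block of \<open>G (rep k) (rep m)\<close> in row \<open>s\<close> and column
  \<open>t\<close> lies below the diagonal, hence vanishes.\<close>

lemma S_mono:
  assumes "k < m" "m < length q" "t < s" "s < length r"
  shows "S k s ** S m t = 0"
proof -
  have k: "k < length q" using assms by simp
  note i = rep[OF k] and j = rep[OF assms(2)]
  have "G (rep k) (rep m) \<in> nest_alg r"
    unfolding G_def using i j assms by (intro nest adapted_basis_unit_nest_alg[OF u]) auto
  then have "r ! s ** G (rep k) (rep m) ** r ! t = 0"
    using assms nest_alg_iff[OF r] by blast
  then show ?thesis
    using atom_G_atom_eq_0_iff[OF i(1) j(1), of s t] i(2) j(2) assms by simp
qed

text \<open>The two products correspond to nonzero blocks of one order conserving matrix,
  \<open>G (rep k) (rep m)\<close>.\<close>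

lemma S_cross:
  assumes "k < m" "m < length q" "s < length r" "t < length r" "s' < length r" "t' < length r"
    and "S k s ** S m t \<noteq> 0" "S k s' ** S m t' \<noteq> 0"
  shows "\<not> (s' < s \<and> t < t')"
proof
  assume st: "s' < s \<and> t < t'"
  have k: "k < length q" using assms by simp
  note i = rep[OF k] and j = rep[OF assms(2)]
  have v: "G (rep k) (rep m) \<in> Pisom_oc r"
    unfolding G_def using i j assms by (intro oc unit_Pisom_oc) auto
  have nz: "r ! s ** G (rep k) (rep m) ** r ! t \<noteq> 0" "r ! s' ** G (rep k) (rep m) ** r ! t' \<noteq> 0"
    using atom_G_atom_eq_0_iff[OF i(1) j(1)] i(2) j(2) assms by simp_all
  show False
    using Pisom_oc_order[OF v nz(1) assms(3) conjunct1[OF st] conjunct2[OF st] assms(6)] nz(2)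
    by contradiction
qed

text \<open>Here the hypothesis on ranks enters: an atom of rank at least two leaves room for the
  summand \<open>outer (u d) (u d)\<close> next to \<open>outer (u c) (u c')\<close>.\<close>

lemma sum_of_units_Pisom_oc:
  assumes c: "c < N" "c' < N" "d < N" "\<beta> c < \<beta> c'" "d \<noteq> c" "d \<noteq> c'" "\<beta> d \<in> {\<beta> c, \<beta> c'}"
  shows "outer (u d) (u d) + outer (u c) (u c') \<in> Pisom_oc q"
proof -
  let ?v = "outer (u d) (u d) + outer (u c) (u c')"
  have block: "q ! s ** ?v ** q ! t = (if s = \<beta> d \<and> t = \<beta> d then outer (u d) (u d)
      else if s = \<beta> c \<and> t = \<beta> c' then outer (u c) (u c') else 0)"
    if "s < length q" "t < length q" for s t
  proof -
    have "q ! s ** ?v ** q ! t = (if \<beta> d = s \<and> \<beta> d = t then outer (u d) (u d) else 0)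
        + (if \<beta> c = s \<and> \<beta> c' = t then outer (u c) (u c') else 0)"
      using that c(1-3)
      by (simp add: matrix_add_ldistrib matrix_add_rdistrib adapted_basis_sandwich[OF u] del: if_split)
    then show ?thesis using c(4) by auto
  qed
  have unit: "adj (outer (u i) (u j)) ** outer (u i) (u j) = outer (u j) (u j)"
    if "i < N" "j < N" for i j
    using that by (simp add: outer_mult_outer basis_cinner[OF basis])
  have proj: "projection (outer (u i) (u i))" if "i < N" for i
    using that by (simp add: projection_outer basis_cinner[OF basis])
  have "adj ?v ** ?v = outer (u d) (u d) + outer (u c') (u c')"
    using c by (simp add: adj_add matrix_add_ldistrib matrix_add_rdistrib outer_mult_outer basis_cinner[OF basis])
  moreover have "projection (outer (u d) (u d) + outer (u c') (u c'))"
    using c by (intro projection_add proj) (auto simp: outer_mult_outer basis_cinner[OF basis])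
  ultimately have v: "partial_isometry ?v" by (simp add: partial_isometry_def)
  have nest_v: "?v \<in> nest_alg q" using c by (auto simp: nest_alg_iff[OF q] block)
  have block_v: "partial_isometry (q ! s ** ?v ** q ! t)" if "s < length q" "t < length q" for s t
    unfolding block[OF that] partial_isometry_def using c by (auto simp: unit[unfolded adj_outer] proj)
  \<comment> \<open>The two nonzero blocks share their row or their column, so neither lies strictly
    above and to the right of the other.\<close>
  have order_v: "q ! a ** ?v ** q ! b = 0"
    if ij: "q ! i ** ?v ** q ! j \<noteq> 0" "i < length q" "j < length q" and ab: "a < i" "j < b" "b < length q"
    for a b i j
  proof -
    have a: "a < length q" using ij(2) ab(1) by simp
    have "i = \<beta> d \<and> j = \<beta> d \<or> i = \<beta> c \<and> j = \<beta> c'"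
      using ij(1) unfolding block[OF ij(2,3)] by (auto split: if_splits)
    moreover have "\<beta> d = \<beta> c \<or> \<beta> d = \<beta> c'" using c(7) by simp
    ultimately have "\<not> (a = \<beta> d \<and> b = \<beta> d)" "\<not> (a = \<beta> c \<and> b = \<beta> c')"
      using ab(1,2) c(4) by arith+
    then show ?thesis unfolding block[OF a ab(3)] by (simp only: if_False)
  qed
  show ?thesis
    unfolding Pisom_oc_def Pisom_reg_def mem_Collect_eq
    by (intro conjI allI impI v nest_v block_v, assumption+) (elim conjE, rule order_v, assumption+)
qed

text \<open>With a further index \<open>e\<close> in the block \<open>d\<close>, the image of
  \<open>outer (u e) (u e) + outer (u i) (u j)\<close> has nonzero blocks at \<open>(x, x)\<close>
  and \<open>(s, t)\<close>. For \<open>s < x\<close> and \<open>x < t\<close> these violate order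
  conservation.\<close>

lemma S_gap:
  assumes km: "k < m" "m < length q" and d: "d \<in> {k, m}" and st: "s < length r" "t < length r"
    and nz: "S k s ** S m t \<noteq> 0" "S d x \<noteq> 0"
  shows "\<not> (s < x \<and> x < t)"
proof
  assume x: "s < x \<and> x < t"
  have k: "k < length q" using km by simp
  obtain i i' where i: "i < N" "i' < N" "i \<noteq> i'" "\<beta> i = k" "\<beta> i' = k" using block_ex2[OF k] by blast
  obtain j j' where j: "j < N" "j' < N" "j \<noteq> j'" "\<beta> j = m" "\<beta> j' = m" using block_ex2[OF km(2)] by blast
  \<comment> \<open>The second index of the block \<open>d\<close>, which avoids both
    \<open>i\<close> and \<open>j\<close>.\<close>
  define e where "e = (if d = k then i' else j')"
  have e: "e < N" "e \<noteq> i" "e \<noteq> j" "\<beta> e = d" using i j d km by (auto simp: e_def)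
  have xl: "x < length r" using x st by simp
  let ?v = "outer (u e) (u e) + outer (u i) (u j)"
  have v: "\<Phi> ?v = G e e + G i j" by (simp add: star_hom_add[OF hom] G_def)
  have v_oc: "\<Phi> ?v \<in> Pisom_oc r"
    using e i j d km by (intro oc sum_of_units_Pisom_oc) auto
  have corner: "r ! s ** \<Phi> ?v ** r ! t \<noteq> 0"
  proof -
    have "r ! s ** G e e ** r ! t = G e e ** (r ! s ** r ! t)"
      using atom_G_commute[OF e(1) e(1) refl st(1)] by (simp add: matrix_mul_assoc)
    then have "r ! s ** G e e ** r ! t = 0"
      using x st by (simp add: ordered_decomposition_mult[OF r])
    moreover have "r ! s ** G i j ** r ! t \<noteq> 0"
      using atom_G_atom_eq_0_iff[OF i(1) j(1) st] i j nz by simp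
    ultimately show ?thesis by (simp add: v matrix_add_ldistrib matrix_add_rdistrib)
  qed
  have centre: "r ! x ** \<Phi> ?v ** r ! x \<noteq> 0"
  proof
    assume "r ! x ** \<Phi> ?v ** r ! x = 0"
    \<comment> \<open>Multiplication by \<open>G e e\<close> removes the summand
      \<open>G i j\<close>, since \<open>e \<noteq> i\<close>.\<close>
    then have "G e e ** (r ! x ** \<Phi> ?v ** r ! x) = 0" by simp
    moreover have "G e e ** (r ! x ** \<Phi> ?v ** r ! x) = r ! x ** (G e e ** \<Phi> ?v) ** r ! x"
      using atom_G_commute[OF e(1) e(1) refl xl] by (simp only: matrix_mul_assoc)
    moreover have "G e e ** \<Phi> ?v = G e e"
      using e i j by (simp add: v matrix_add_ldistrib G_mult)
    ultimately have "r ! x ** G e e ** r ! x = 0" by simp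
    then have "S d x ** S d x = 0" using atom_G_atom_eq_0_iff[OF e(1) e(1) xl xl] e by simp
    then show False using nz(2) S_mult[of d x x] d k km xl by auto
  qed
  show False
    using Pisom_oc_order[OF v_oc centre xl conjunct1[OF x] conjunct2[OF x] st(2)] corner
    by contradiction
qed

section \<open>Joint eigenvectors of the commuting projections\<close>

text \<open>\<open>F\<close> consists of the functions \<open>f\<close> such that some vector of the multiplicity space is placed
  by \<open>\<Phi>\<close>, for each \<open>k\<close>, from the atom \<open>q ! k\<close> into the atom \<open>r ! f k\<close>.\<close>

definition F :: "(nat \<Rightarrow> nat) set" where
  "F = {f. (\<forall>k<length q. f k < length r) \<and> (\<exists>x. x \<noteq> 0 \<and> (\<forall>k<length q. S k (f k) *v x = x))}"

lemma F_less: "f \<in> F \<Longrightarrow> k < length q \<Longrightarrow> f k < length r"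
  by (simp add: F_def)

lemma F_nonzero:
  assumes "f \<in> F" "k < length q" "m < length q"
  shows "S k (f k) ** S m (f m) \<noteq> 0"
proof
  assume *: "S k (f k) ** S m (f m) = 0"
  obtain x where "x \<noteq> 0" "S k (f k) *v x = x" "S m (f m) *v x = x"
    using assms by (auto simp: F_def)
  then have "x = (S k (f k) ** S m (f m)) *v x" by (simp add: matrix_vector_mul_assoc[symmetric])
  then show False using * \<open>x \<noteq> 0\<close> by simp
qed

lemma F_mono:
  assumes "f \<in> F" "k < m" "m < length q"
  shows "f k \<le> f m"
  using S_mono[OF assms(2,3), of "f m" "f k"] F_nonzero[of f k m] F_less[of f k] assms
  by (meson less_trans not_le)

lemma length_q: "0 < length q"
proof -
  have "(mat 1 :: complex^'n^'n) \<noteq> 0" by (simp add: mat_def vec_eq_iff)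
  then show ?thesis using ordered_decomposition_sum[OF q] by (cases "length q = 0") auto
qed

lemma F_dichotomy:
  assumes fg: "f \<in> F" "g \<in> F"
  shows "f (length q - 1) \<le> g 0 \<or> g (length q - 1) \<le> f 0 \<or>
    f 0 = g 0 \<and> f (length q - 1) = g (length q - 1) \<and>
    ((\<forall>i<length q. f i = g i) \<or> (\<forall>i<length q. f i \<in> {f 0, f (length q - 1)}))"
proof -
  have cross: "\<not> (g' i < f' i \<and> f' j < g' j)"
    if "f' \<in> F" "g' \<in> F" "i < j" "j < length q" for f' g' i j
    using S_cross[OF that(3,4), of "f' i" "f' j" "g' i" "g' j"] F_nonzero[OF that(1), of i j]
      F_nonzero[OF that(2), of i j] F_less[OF that(1)] F_less[OF that(2)] that by simp
  have gap: "\<not> (f' i < g' d \<and> g' d < f' j)"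
    if "f' \<in> F" "g' \<in> F" "i < j" "j < length q" "d \<in> {i, j}" for f' g' i j d
  proof -
    have "S d (g' d) \<noteq> 0" using F_nonzero[OF that(2), of d d] that by auto
    then show ?thesis
      using S_gap[OF that(3,4,5), of "f' i" "f' j" "g' d"] F_nonzero[OF that(1), of i j]
        F_less[OF that(1)] that by simp
  qed
  show ?thesis
    by (rule monotone_chain_dichotomy[OF length_q F_mono[OF fg(1)] F_mono[OF fg(2)]
          cross[OF fg] cross[OF fg(2,1)] gap[OF fg] gap[OF fg(2,1)]])
qed

text \<open>A common eigenvector in the range of \<open>Z\<close> is built one position
  \<open>m\<close> at a time: the projections \<open>S m s\<close> sum to \<open>E\<close>, so one
  of them does not annihilate the current vector, and by commutation its image keeps the eigenvalues
  found before.\<close>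

lemma F_spectral:
  assumes Z: "Z ** Z = Z" "Z \<noteq> 0" "E ** Z = Z"
    and comm: "\<And>k s. k < length q \<Longrightarrow> s < length r \<Longrightarrow> Z ** S k s = S k s ** Z"
  shows "\<exists>f\<in>F. \<exists>x. x \<noteq> 0 \<and> Z *v x = x \<and> (\<forall>k<length q. S k (f k) *v x = x)"
proof -
  have "\<exists>f x. x \<noteq> 0 \<and> Z *v x = x \<and> (\<forall>k<m. f k < length r \<and> S k (f k) *v x = x)"
    if "m \<le> length q" for m
    using that
  proof (induction m)
    case 0
    obtain y where "Z *v y \<noteq> 0" using Z(2) by (auto simp: matrix_eq)
    \<comment> \<open>The initial function is a placeholder; its values are replaced as
      \<open>m\<close> grows.\<close>
    then show ?case using Z(1) by (intro exI[of _ "\<lambda>_. 0"] exI[of _ "Z *v y"]) (simp add: matrix_vector_mul_assoc)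
  next
    case (Suc m)
    then obtain f x where x: "x \<noteq> 0" "Z *v x = x" and f: "\<forall>k<m. f k < length r \<and> S k (f k) *v x = x"
      using Suc_leD by blast
    have m: "m < length q" using Suc.prems by simp
    have "(\<Sum>s<length r. S m s *v x) = E *v (Z *v x)"
      using x by (simp add: S_sum[OF m, symmetric] matrix_sum_mult_vec)
    also have "\<dots> = x" by (subst matrix_vector_mul_assoc) (simp add: Z(3) x)
    finally obtain s where s: "s < length r" "S m s *v x \<noteq> 0"
      using x(1) by (metis (no_types, lifting) lessThan_iff sum.neutral)
    have "Z *v (S m s *v x) = S m s *v x"
      using matrix_mult_vec_swap[OF comm[OF m s(1)], of x] x by simp
    moreover have "S k ((f(m := s)) k) *v (S m s *v x) = S m s *v x" if "k < Suc m" for k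
    proof (cases "k = m")
      case True
      then show ?thesis using S_mult[OF m s(1) s(1)] by (simp add: matrix_vector_mul_assoc)
    next
      case False
      then have k: "k < m" "k < length q" using that m by auto
      have "S k (f k) *v (S m s *v x) = S m s *v (S k (f k) *v x)"
        using S_commute[OF k(2) m _ s(1), of "f k"] f k(1) by (intro matrix_mult_vec_swap) auto
      then show ?thesis using f k False by simp
    qed
    ultimately show ?case using s f by (intro exI[of _ "f(m := s)"] exI[of _ "S m s *v x"]) (auto simp: less_Suc_eq)
  qed
  from this[OF order_refl] show ?thesis unfolding F_def by blast
qed

end

section \<open>The ordered sum\<close>

lemma op_leI_projection:
  assumes "projection (b - a)"
  shows "op_le a b"
proof -
  have "0 \<le> x \<bullet> ((b - a) *v x)" for x
  proof -
    have "x \<bullet> ((b - a) *v x) = Re (cinner x ((b - a) *v ((b - a) *v x)))"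
      by (simp only: inner_eq_Re_cinner projection_idem[OF assms])
    also have "\<dots> = Re (cinner ((b - a) *v x) ((b - a) *v x))"
      by (simp only: projection_cinner[OF assms])
    finally show ?thesis by (simp add: cinner_self)
  qed
  then show ?thesis using assms by (simp add: op_le_def projection_def)
qed

text \<open>If \<open>a *v x = 0\<close>, the quadratic form of \<open>a - outer x x\<close> at
  \<open>x\<close> is minus the fourth power of the norm of \<open>x\<close>.\<close>

lemma op_le_outer_nonzero:
  assumes "op_le (outer x x) a" "x \<noteq> 0"
  shows "a *v x \<noteq> 0"
proof
  assume "a *v x = 0"
  then have "(a - outer x x) *v x = (- cinner x x) *s x"
    by (simp add: matrix_vector_mult_diff_rdistrib vec_eq_iff)
  then have "x \<bullet> ((a - outer x x) *v x) = Re (- cinner x x * cinner x x)"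
    by (simp only: inner_eq_Re_cinner cinner_scale_right)
  also have "\<dots> = - ((norm x)\<^sup>2 * (norm x)\<^sup>2)"
    by (simp add: cinner_self flip: of_real_mult of_real_power)
  finally have "\<not> 0 \<le> x \<bullet> ((a - outer x x) *v x)" using assms(2) by simp
  then show False using assms(1) unfolding op_le_def by blast
qed

context order_conserving_rep
begin

section \<open>The summands cut out by first and last values\<close>

text \<open>Selects the joint eigenvectors whose function has first value \<open>a\<close> and last
  value \<open>b\<close>; over all pairs of positions of atoms these projections split
  \<open>E\<close>.\<close>

definition P :: "nat \<Rightarrow> nat \<Rightarrow> complex^'m^'m" where
  "P a b = S 0 a ** S (length q - 1) b"

definition \<psi> :: "nat \<Rightarrow> nat \<Rightarrow> complex^'n^'n \<Rightarrow> complex^'m^'m" where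
  "\<psi> a b x = \<Phi> x ** P a b"

lemma last_block: "length q - 1 < length q"
  using length_q by simp

lemma F_between:
  assumes "f \<in> F" "k < length q"
  shows "f 0 \<le> f k" "f k \<le> f (length q - 1)"
proof -
  show "f 0 \<le> f k" using F_mono[OF assms(1), of 0 k] assms(2) by (cases "k = 0") auto
  show "f k \<le> f (length q - 1)"
  proof (cases "k = length q - 1")
    case False
    then have "k < length q - 1" using assms(2) by simp
    then show ?thesis by (rule F_mono[OF assms(1) _ last_block])
  qed simp
qed

lemma P_commutant: "P a b \<in> commutant"
  unfolding P_def by (intro commutant_mult S_commutant length_q last_block)

lemma P_star_hom: "P a b ** \<Phi> x = \<Phi> x ** P a b"
  by (rule commutant_star_hom[OF P_commutant])

lemma P_G: "i < N \<Longrightarrow> j < N \<Longrightarrow> P a b ** G i j = G i j ** P a b"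
  by (rule commutant_G[OF P_commutant])

lemma P_E: "P a b ** E = P a b" "E ** P a b = P a b"
  using commutant_E[OF P_commutant] P_star_hom by simp_all

lemma S_eigenvalue_unique:
  assumes "k < length q" "s < length r" "t < length r" "S k s *v x = x" "S k t *v x = x" "x \<noteq> 0"
  shows "s = t"
proof (rule ccontr)
  assume "s \<noteq> t"
  then have "S k s *v (S k t *v x) = 0"
    using S_mult[OF assms(1-3)] by (simp add: matrix_vector_mul_assoc)
  then show False using assms(4-6) by simp
qed

context
  fixes a b :: nat
  assumes ab: "a < length r" "b < length r"
begin

lemma P_S: "k < length q \<Longrightarrow> s < length r \<Longrightarrow> P a b ** S k s = S k s ** P a b"
  using S_commute[OF length_q _ ab(1), of k s] S_commute[OF last_block _ ab(2), of k s]
  unfolding P_def by (metis matrix_mul_assoc)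

lemma P_projection: "projection (P a b)"
  unfolding P_def
  by (intro projection_mult S_projection S_commute ab length_q last_block)

lemma P_idem: "P a b ** P a b = P a b" and P_adj: "adj (P a b) = P a b"
  using P_projection by (simp_all add: projection_def)

text \<open>\<open>S k s ** P a b\<close> is a projection below \<open>S k s\<close>,
  \<open>S 0 a\<close> and \<open>S (length q - 1) b\<close>, so an eigenvector from
  \<open>F_spectral\<close> in its range has a function with the three prescribed values.\<close>

lemma F_of_S_P:
  assumes ks: "k < length q" "s < length r" "S k s ** P a b \<noteq> 0"
  shows "\<exists>f\<in>F. f 0 = a \<and> f (length q - 1) = b \<and> f k = s"
proof -
  let ?Z = "S k s ** P a b"
  have proj: "projection ?Z"
    by (intro projection_mult S_projection P_projection P_S[symmetric] ks)
  have "?Z ** S m t = S m t ** ?Z" if "m < length q" "t < length r" for m t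
    using S_commute[OF ks(1) that(1) ks(2) that(2)] P_S[OF that] by (metis matrix_mul_assoc)
  moreover have "E ** ?Z = ?Z"
    using commutant_star_hom[OF commutant_mult[OF S_commutant[OF ks(1)] P_commutant], of s a b "mat 1"]
      commutant_E[OF commutant_mult[OF S_commutant[OF ks(1)] P_commutant], of s a b] by simp
  ultimately obtain f x where f: "f \<in> F" and x: "x \<noteq> 0" "?Z *v x = x"
    and fx: "\<And>m. m < length q \<Longrightarrow> S m (f m) *v x = x"
    using F_spectral[of ?Z] proj ks(3) unfolding projection_def by blast
  have fixes_x: "S m t *v x = x" if "S m t ** ?Z = ?Z" for m t
    using that x(2) by (metis matrix_vector_mul_assoc)
  have "S k s ** ?Z = ?Z"
    using S_mult[OF ks(1) ks(2) ks(2)] by (simp add: matrix_mul_assoc)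
  moreover have "S 0 a ** ?Z = ?Z"
  proof -
    have "S 0 a ** ?Z = S k s ** (S 0 a ** S 0 a) ** S (length q - 1) b"
      using S_commute[OF length_q ks(1) ab(1) ks(2)] unfolding P_def by (simp add: matrix_mul_assoc)
    then show ?thesis by (simp add: S_mult[OF length_q ab(1) ab(1)] P_def matrix_mul_assoc)
  qed
  moreover have "S (length q - 1) b ** ?Z = ?Z"
  proof -
    have "S (length q - 1) b ** ?Z = S k s ** (S (length q - 1) b ** P a b)"
      using S_commute[OF last_block ks(1) ab(2) ks(2)] by (simp add: matrix_mul_assoc)
    also have "\<dots> = S k s ** (P a b ** S (length q - 1) b)"
      by (simp only: P_S[OF last_block ab(2)])
    also have "P a b ** S (length q - 1) b = P a b"
      using S_mult[OF last_block ab(2) ab(2)] by (simp add: P_def matrix_mul_assoc[symmetric])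
    finally show ?thesis .
  qed
  ultimately have "f k = s" "f 0 = a" "f (length q - 1) = b"
    using S_eigenvalue_unique[OF _ _ _ fx fixes_x x(1)] F_less[OF f] ks ab length_q last_block
    by metis+
  then show ?thesis using f by blast
qed

lemma F_of_P:
  assumes "P a b \<noteq> 0"
  shows "\<exists>f\<in>F. f 0 = a \<and> f (length q - 1) = b"
proof -
  have "S 0 a ** P a b = P a b" using S_mult[OF length_q ab(1) ab(1)] by (simp add: P_def matrix_mul_assoc)
  then show ?thesis using F_of_S_P[OF length_q ab(1)] assms by auto
qed

lemma atom_P: "s < length r \<Longrightarrow> r ! s ** P a b = (\<Sum>i<N. S (\<beta> i) s ** P a b ** G i i)"
proof -
  assume s: "s < length r"
  have "r ! s ** P a b = r ! s ** (\<Sum>i<N. G i i) ** P a b"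
    by (simp add: G_sum matrix_mul_assoc[symmetric] P_E)
  also have "\<dots> = (\<Sum>i<N. S (\<beta> i) s ** P a b ** G i i)"
    unfolding matrix_sum_mult_left matrix_sum_mult_right
    by (rule sum.cong) (use s in \<open>auto simp: S_mult_G[symmetric] P_G matrix_mul_assoc[symmetric]\<close>)
  finally show ?thesis .
qed

text \<open>Both products equal the sum of the operators
  \<open>S (\<beta> i) s ** P a b ** G i i\<close>, because the atom acts as
  \<open>S (\<beta> i) s\<close> on the corner at \<open>i\<close>.\<close>

lemma atom_P_commute:
  assumes s: "s < length r"
  shows "r ! s ** P a b = P a b ** r ! s"
proof -
  have "P a b ** r ! s = P a b ** (\<Sum>i<N. G i i) ** r ! s"
    by (simp add: G_sum P_E)
  also have "\<dots> = (\<Sum>i<N. S (\<beta> i) s ** P a b ** G i i)"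
    unfolding matrix_sum_mult_left matrix_sum_mult_right
  proof (rule sum.cong[OF refl])
    fix i assume "i \<in> {..<N}"
    then have i: "i < N" by simp
    have "P a b ** G i i ** r ! s = P a b ** (r ! s ** G i i)"
      using atom_G_commute[OF i i refl s] by (simp add: matrix_mul_assoc)
    also have "\<dots> = (P a b ** S (\<beta> i) s) ** G i i"
      by (simp only: S_mult_G[OF i i s, symmetric] matrix_mul_assoc)
    finally show "P a b ** G i i ** r ! s = S (\<beta> i) s ** P a b ** G i i"
      by (simp only: P_S[OF block_less[OF i] s])
  qed
  finally show ?thesis using atom_P[OF s] by simp
qed

lemma F_of_atom_P:
  assumes s: "s < length r" and nz: "r ! s ** P a b \<noteq> 0"
  shows "\<exists>f\<in>F. f 0 = a \<and> f (length q - 1) = b \<and> (\<exists>k<length q. f k = s)"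
proof -
  obtain i where i: "i < N" "S (\<beta> i) s ** P a b ** G i i \<noteq> 0"
    using nz unfolding atom_P[OF s] by (meson lessThan_iff sum.neutral)
  then have "S (\<beta> i) s ** P a b \<noteq> 0" by auto
  then show ?thesis using F_of_S_P[OF block_less[OF i(1)] s] block_less[OF i(1)] by blast
qed

lemma psi_star_hom: "star_hom (\<psi> a b)"
  unfolding star_hom_def \<psi>_def
proof (intro conjI allI)
  fix x y c
  show "\<Phi> (x + y) ** P a b = \<Phi> x ** P a b + \<Phi> y ** P a b"
    by (simp add: star_hom_add[OF hom] matrix_add_rdistrib)
  show "\<Phi> (mat c ** x) ** P a b = mat c ** (\<Phi> x ** P a b)"
    by (simp add: star_hom_scale[OF hom] matrix_mul_assoc)
  have "\<Phi> x ** P a b ** (\<Phi> y ** P a b) = \<Phi> x ** (P a b ** \<Phi> y) ** P a b"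
    by (simp only: matrix_mul_assoc)
  also have "\<dots> = \<Phi> x ** \<Phi> y ** (P a b ** P a b)"
    by (simp only: P_star_hom matrix_mul_assoc)
  finally show "\<Phi> (x ** y) ** P a b = \<Phi> x ** P a b ** (\<Phi> y ** P a b)"
    by (simp add: star_hom_mult[OF hom] P_idem)
  show "\<Phi> (adj x) ** P a b = adj (\<Phi> x ** P a b)"
    by (simp add: star_hom_adj[OF hom] adj_mult P_adj) (simp only: star_hom_adj[OF hom, symmetric] P_star_hom)
qed

lemma psi_nest_alg:
  assumes "x \<in> nest_alg q"
  shows "\<psi> a b x \<in> nest_alg r"
proof -
  have "r ! s ** \<psi> a b x ** r ! t = 0" if st: "s < length r" "t < s" for s t
  proof -
    have "r ! s ** \<psi> a b x ** r ! t = r ! s ** \<Phi> x ** (P a b ** r ! t)"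
      by (simp only: \<psi>_def matrix_mul_assoc)
    also have "P a b ** r ! t = r ! t ** P a b" using atom_P_commute[of t] st by simp
    also have "r ! s ** \<Phi> x ** (r ! t ** P a b) = (r ! s ** \<Phi> x ** r ! t) ** P a b"
      by (simp only: matrix_mul_assoc)
    also have "r ! s ** \<Phi> x ** r ! t = 0" using nest[OF assms] st by (simp add: nest_alg_iff[OF r])
    finally show ?thesis by simp
  qed
  then show ?thesis by (simp add: nest_alg_iff[OF r])
qed

lemma psi_star_extendible: "star_extendible q r (\<psi> a b)"
  unfolding star_extendible_def using psi_star_hom psi_nest_alg by blast

text \<open>Each entry of a difference can be read off a corner: compressing by \<open>G i i\<close>
  and \<open>G j j\<close> leaves that entry times \<open>G i j ** P a b\<close>, which is
  nonzero.\<close>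

lemma psi_inj:
  assumes "P a b \<noteq> 0"
  shows "inj (\<psi> a b)"
proof (rule injI)
  fix x y assume "\<psi> a b x = \<psi> a b y"
  then have 0: "\<Phi> (x - y) ** P a b = 0"
    by (simp add: \<psi>_def star_hom_diff[OF hom] matrix_diff_rdistrib)
  show "x = y"
  proof (rule basis_entry_eqI[OF basis])
    fix i j assume "i \<in> {..<N}" "j \<in> {..<N}"
    then have ij: "i < N" "j < N" by auto
    have "mat (entry u (x - y) i j) ** G i j ** P a b = G i i ** \<Phi> (x - y) ** G j j ** P a b"
      unfolding G_def
      by (simp only: star_hom_mult[OF hom, symmetric] star_hom_scale[OF hom, symmetric] outer_sandwich[of u])
    also have "\<dots> = G i i ** (\<Phi> (x - y) ** P a b) ** G j j"
      using P_G[OF ij(2) ij(2)] by (simp add: matrix_mul_assoc[symmetric])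
    finally have "mat (entry u (x - y) i j) ** (G i j ** P a b) = 0"
      by (simp add: 0 matrix_mul_assoc)
    moreover have "G i j ** P a b \<noteq> 0"
      using commutant_mult_G_eq_0[OF P_commutant ij] assms P_G[OF ij] by auto
    ultimately have "entry u (x - y) i j = 0" by (simp add: mat_nonzero_mult_eq_0_iff)
    then show "entry u x i j = entry u y i j"
      by (simp add: entry_def matrix_vector_mult_diff_rdistrib cinner_diff_right)
  qed
qed

lemma psi_embedding: "P a b \<noteq> 0 \<Longrightarrow> star_extendible_embedding q r (\<psi> a b)"
  using psi_star_extendible psi_inj unfolding star_extendible_embedding_def
  by (metis inj_on_subset subset_UNIV)

text \<open>Atoms other than \<open>r ! a\<close> and \<open>r ! b\<close> annihilate
  \<open>P a b\<close>, since their positions are not values of a function with this pair. As the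
  atoms sum to the identity, \<open>P a b\<close> lies below the sum of these two.\<close>

lemma psi_T2_degenerate:
  assumes nz: "P a b \<noteq> 0" and "a \<noteq> b"
    and two: "\<And>f k. f \<in> F \<Longrightarrow> f 0 = a \<Longrightarrow> f (length q - 1) = b \<Longrightarrow> k < length q \<Longrightarrow> f k \<in> {a, b}"
  shows "T2_degenerate_type q r (\<psi> a b)"
proof -
  have "P a b = (\<Sum>s<length r. r ! s) ** P a b" by (simp add: ordered_decomposition_sum[OF r])
  also have "\<dots> = (\<Sum>s<length r. r ! s ** P a b)" by (rule matrix_sum_mult_left)
  also have "\<dots> = (\<Sum>s\<in>{a, b}. r ! s ** P a b)"
    using ab F_of_atom_P two by (intro sum.mono_neutral_right) auto
  finally have "(r ! a + r ! b) ** P a b = P a b"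
    using \<open>a \<noteq> b\<close> by (simp add: matrix_add_rdistrib)
  then have "projection (r ! a + r ! b - P a b)"
    using ab \<open>a \<noteq> b\<close> ordered_decomposition_mult[OF r ab]
    by (intro projection_diff projection_add P_projection ordered_decomposition_projection[OF r]) auto
  then have "op_le (\<psi> a b (mat 1)) (r ! a + r ! b)"
    unfolding \<psi>_def P_E by (rule op_leI_projection)
  then show ?thesis
    using ab psi_embedding[OF nz] unfolding T2_degenerate_type_def by (meson nth_mem)
qed

section \<open>Summands with a single function\<close>

context
  fixes f0 :: "nat \<Rightarrow> nat"
  assumes nz: "P a b \<noteq> 0"
    and uniq: "\<And>f k. f \<in> F \<Longrightarrow> f 0 = a \<Longrightarrow> f (length q - 1) = b \<Longrightarrow> k < length q \<Longrightarrow> f k = f0 k"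
begin

lemma uniq_less: "k < length q \<Longrightarrow> f0 k < length r"
  and uniq_mono: "k \<le> m \<Longrightarrow> m < length q \<Longrightarrow> f0 k \<le> f0 m"
proof -
  obtain f where f: "f \<in> F" "f 0 = a" "f (length q - 1) = b" using F_of_P[OF nz] by blast
  have eq: "f0 k = f k" if "k < length q" for k using uniq[OF f that] by simp
  show "k < length q \<Longrightarrow> f0 k < length r" using F_less[OF f(1)] eq by simp
  assume km: "k \<le> m" "m < length q"
  then show "f0 k \<le> f0 m"
    using F_mono[OF f(1), of k m] eq[of k] eq[of m] by (cases "k = m") auto
qed

text \<open>For \<open>t \<noteq> f0 (\<beta> i)\<close> the product
  \<open>S (\<beta> i) t ** P a b\<close> is zero by uniqueness; since these projections sum to
  \<open>E\<close>, the remaining one fixes \<open>P a b\<close>.\<close>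

lemma atom_G_P:
  assumes "i < N" "j < N" "s < length r"
  shows "r ! s ** (G i j ** P a b) = (if s = f0 (\<beta> i) then G i j ** P a b else 0)"
proof -
  note k = block_less[OF assms(1)]
  have zero: "S (\<beta> i) t ** P a b = 0" if "t < length r" "t \<noteq> f0 (\<beta> i)" for t
    using F_of_S_P[OF k that(1)] uniq[OF _ _ _ k] that(2) by blast
  have "P a b = (\<Sum>t<length r. S (\<beta> i) t) ** P a b" by (simp add: S_sum[OF k] P_E)
  also have "\<dots> = (\<Sum>t<length r. S (\<beta> i) t ** P a b)" by (rule matrix_sum_mult_left)
  also have "\<dots> = (\<Sum>t\<in>{f0 (\<beta> i)}. S (\<beta> i) t ** P a b)"
    using zero uniq_less[OF k] by (intro sum.mono_neutral_right) auto
  finally have one: "S (\<beta> i) (f0 (\<beta> i)) ** P a b = P a b" by simp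
  have "r ! s ** (G i j ** P a b) = (S (\<beta> i) s ** G i j) ** P a b"
    by (simp only: S_mult_G[OF assms] matrix_mul_assoc)
  also have "\<dots> = S (\<beta> i) s ** (P a b ** G i j)"
    by (simp only: P_G[OF assms(1,2)] matrix_mul_assoc)
  also have "\<dots> = (S (\<beta> i) s ** P a b) ** G i j" by (simp only: matrix_mul_assoc)
  finally show ?thesis using zero[OF assms(3)] one P_G[OF assms(1,2)] by auto
qed

text \<open>The range of \<open>G i i ** P a b\<close> is spanned by the images under \<open>G i 0\<close> of a basis of the
  range of \<open>G 0 0 ** P a b\<close>; in the basis of the whole space these vectors come first
  inside each atom of \<open>r\<close>, ordered by \<open>i\<close>.\<close>

lemma refining_basis:
  shows "\<exists>(I :: nat list set) w d. adapted_basis r I w hd \<and>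
    (\<forall>i<N. \<forall>s<d. [f0 (\<beta> i), i, s] \<in> I) \<and>
    (\<forall>i<N. \<forall>j<N. G i j ** P a b = (\<Sum>s<d. outer (w [f0 (\<beta> i), i, s]) (w [f0 (\<beta> j), j, s])))"
proof -
  have N: "0 < N" using rep(1)[OF length_q] by simp
  have G0: "projection (G 0 0)" using N by (simp add: projection_def G_mult G_adj)
  have GP: "projection (G 0 0 ** P a b)"
    by (intro projection_mult G0 P_projection P_G[symmetric] N)
  obtain d y where y: "orthonormal_on {..<d::nat} y" "G 0 0 ** P a b = (\<Sum>s<d. outer (y s) (y s))"
    using projection_decomposition[OF GP] by blast
  have GPy: "G 0 0 *v (P a b *v y s) = y s" if "s < d" for s
    using outer_sum_fixes[OF y(1), of s] that y(2) by (simp add: matrix_vector_mul_assoc)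
  have Py: "P a b *v y s = y s" and Gy: "G 0 0 *v y s = y s" if "s < d" for s
  proof -
    have "P a b *v y s = P a b *v (G 0 0 *v (P a b *v y s))" by (simp only: GPy[OF that])
    also have "\<dots> = G 0 0 *v (P a b *v (P a b *v y s))"
      by (rule matrix_mult_vec_swap[OF P_G[OF N N]])
    also have "\<dots> = y s" by (simp only: projection_idem[OF P_projection] GPy[OF that])
    finally show "P a b *v y s = y s" .
    then show "G 0 0 *v y s = y s" using GPy[OF that] by simp
  qed
  have PGy: "P a b *v (G i 0 *v y s) = G i 0 *v y s" if "i < N" "s < d" for i s
    using matrix_mult_vec_swap[OF P_G[OF that(1) N], where x = "y s"] Py[OF that(2)] by simp
  have rest: "projection (r ! k - r ! k ** P a b)" if "k < length r" for k
  proof (rule projection_diff)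
    show "projection (r ! k)" by (rule ordered_decomposition_projection[OF r that])
    then show "projection (r ! k ** P a b)"
      by (rule projection_mult[OF _ P_projection atom_P_commute[OF that]])
    show "r ! k ** (r ! k ** P a b) = r ! k ** P a b"
      using ordered_decomposition_mult[OF r that that] by (simp add: matrix_mul_assoc)
  qed
  \<comment> \<open>A single choice per atom yields both the dimension \<open>e k\<close> and the
    basis \<open>z k\<close> of the part of the atom off \<open>P a b\<close>.\<close>
  define Q where "Q k p \<longleftrightarrow> orthonormal_on {..<fst p :: nat} (snd p) \<and>
      r ! k - r ! k ** P a b = (\<Sum>s<fst p. outer (snd p s) (snd p s))" for k p
  define e where "e k = fst (SOME p. Q k p)" for k
  define z where "z k = snd (SOME p. Q k p)" for k
  have z: "orthonormal_on {..<e k} (z k)" "r ! k - r ! k ** P a b = (\<Sum>s<e k. outer (z k s) (z k s))"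
    if k: "k < length r" for k
  proof -
    obtain n v where "orthonormal_on {..<n :: nat} v" "r ! k - r ! k ** P a b = (\<Sum>s<n. outer (v s) (v s))"
      using projection_decomposition[OF rest[OF k]] by blast
    then have "Q k (n, v)" by (simp add: Q_def)
    then have "Q k (SOME p. Q k p)" by (rule someI)
    then have "Q k (e k, z k)" by (simp add: e_def z_def)
    then show "orthonormal_on {..<e k} (z k)"
      "r ! k - r ! k ** P a b = (\<Sum>s<e k. outer (z k s) (z k s))"
      by (simp_all add: Q_def)
  qed
  have zfix: "(r ! k - r ! k ** P a b) *v z k s = z k s" if "k < length r" "s < e k" for k s
    unfolding z(2)[OF that(1)] by (rule outer_sum_fixes[OF z(1)[OF that(1)]]) (use that in simp)
  have rz: "r ! k' *v z k s = (if k' = k then z k s else 0)"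
    if "k < length r" "k' < length r" "s < e k" for k k' s
  proof -
    have "r ! k' ** (r ! k - r ! k ** P a b) = (if k' = k then r ! k - r ! k ** P a b else 0)"
      using ordered_decomposition_mult[OF r that(2,1)] by (simp add: matrix_diff_ldistrib matrix_mul_assoc)
    then have "r ! k' *v ((r ! k - r ! k ** P a b) *v z k s)
        = (if k' = k then (r ! k - r ! k ** P a b) *v z k s else 0)"
      by (simp add: matrix_vector_mul_assoc)
    then show ?thesis by (simp only: zfix[OF that(1,3)])
  qed
  have Pz: "P a b *v z k s = 0" if "k < length r" "s < e k" for k s
  proof -
    have "P a b ** (r ! k - r ! k ** P a b) = P a b ** r ! k - (P a b ** r ! k) ** P a b"
      by (simp only: matrix_diff_ldistrib matrix_mul_assoc)
    also have "\<dots> = r ! k ** P a b - r ! k ** (P a b ** P a b)"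
      by (simp only: atom_P_commute[OF that(1), symmetric] matrix_mul_assoc)
    also have "\<dots> = 0" by (simp add: P_idem)
    finally have "P a b *v ((r ! k - r ! k ** P a b) *v z k s) = 0"
      by (simp add: matrix_vector_mul_assoc)
    then show ?thesis by (simp only: zfix[OF that])
  qed
  have Pv: "cinner v v' = 0" "cinner v' v = 0" if "P a b *v v = v" "P a b *v v' = 0" for v v'
  proof -
    have "cinner v v' = cinner (P a b *v v) v'" by (simp only: that(1))
    also have "\<dots> = 0" by (simp add: projection_cinner[OF P_projection] that(2))
    finally show "cinner v v' = 0" .
    then show "cinner v' v = 0" using cinner_commute[of v' v] by simp
  qed
  \<comment> \<open>A key lists the position of the atom in \<open>r\<close>, the index
    \<open>i\<close> of the source vector, and a running number. The middle entry \<open>N\<close>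
    marks the vectors off the range of \<open>P a b\<close>; it exceeds every \<open>i\<close>, so
    lexicographically they come last in their atom.\<close>
  define w where "w \<kappa> = (if \<kappa> ! 1 < N then G (\<kappa> ! 1) 0 *v y (\<kappa> ! 2) else z (\<kappa> ! 0) (\<kappa> ! 2))"
    for \<kappa> :: "nat list"
  let ?A = "(\<lambda>(i, s). [f0 (\<beta> i), i, s]) ` ({..<N} \<times> {..<d})"
  let ?B = "(\<lambda>(k, s). [k, N, s]) ` (SIGMA k:{..<length r}. {..<e k})"
  let ?I = "?A \<union> ?B"
  have wA: "w [f0 (\<beta> i), i, s] = G i 0 *v y s" if "i < N" for i s
    using that by (simp add: w_def)
  have wB: "w [k, N, s] = z k s" for k s
    by (simp add: w_def)
  have units: "G i j ** P a b = (\<Sum>s<d. outer (w [f0 (\<beta> i), i, s]) (w [f0 (\<beta> j), j, s]))"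
    if "i < N" "j < N" for i j
  proof -
    have "(\<Sum>s<d. outer (w [f0 (\<beta> i), i, s]) (w [f0 (\<beta> j), j, s]))
        = G i 0 ** (\<Sum>s<d. outer (y s) (y s)) ** G 0 j"
      using that by (simp add: wA matrix_sum_mult_left matrix_sum_mult_right mult_outer outer_mult G_adj)
    also have "\<dots> = G i 0 ** G 0 0 ** (P a b ** G 0 j)"
      by (simp only: y(2)[symmetric] matrix_mul_assoc)
    also have "\<dots> = G i 0 ** G 0 0 ** G 0 j ** P a b"
      by (simp only: P_G[OF N that(2)] matrix_mul_assoc)
    finally show ?thesis using that N by (simp add: G_mult)
  qed
  have AA: "cinner (w [f0 (\<beta> i), i, s]) (w [f0 (\<beta> j), j, t]) = (if i = j \<and> s = t then 1 else 0)"
    if "i < N" "j < N" "s < d" "t < d" for i j s t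
  proof -
    have "cinner (G i 0 *v y s) (G j 0 *v y t) = cinner (y s) (G 0 i *v (G j 0 *v y t))"
      using cinner_adj[of "y s" "G 0 i"] by (simp add: G_adj)
    also have "\<dots> = (if i = j then cinner (y s) (y t) else 0)"
      using that N by (simp add: G_mult_vec Gy)
    finally show ?thesis
      using that orthonormal_onD[OF y(1), of s t] orthonormal_onD[OF y(1), of t t] by (simp add: wA)
  qed
  have BB: "cinner (w [k, N, s]) (w [k', N, t]) = (if k = k' \<and> s = t then 1 else 0)"
    if "k < length r" "k' < length r" "s < e k" "t < e k'" for k k' s t
  proof (cases "k = k'")
    case True
    then show ?thesis
      using that orthonormal_onD[OF z(1), of k s t] orthonormal_onD[OF z(1), of k t t]
      by (simp add: wB)
  next
    case False
    have "cinner (z k s) (z k' t) = cinner (r ! k *v z k s) (z k' t)"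
      using rz[of k k s] that by simp
    also have "\<dots> = cinner (z k s) (r ! k *v z k' t)"
      by (rule projection_cinner[OF ordered_decomposition_projection[OF r that(1)]])
    also have "\<dots> = 0" using rz[of k' k t] that False by simp
    finally show ?thesis using False by (simp add: wB)
  qed
  have AB: "cinner (w [f0 (\<beta> i), i, s]) (w [k, N, t]) = 0" "cinner (w [k, N, t]) (w [f0 (\<beta> i), i, s]) = 0"
    if "i < N" "s < d" "k < length r" "t < e k" for i s k t
    using Pv[of "G i 0 *v y s" "z k t"] PGy[OF that(1,2)] Pz[OF that(3,4)] that by (simp_all add: wA wB)
  have on: "orthonormal_on ?I w"
    unfolding orthonormal_on_def
  proof (intro conjI ballI)
    fix \<kappa> \<kappa>' assume "\<kappa> \<in> ?I" "\<kappa>' \<in> ?I"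
    then consider
      (aa) i s j t where "i < N" "s < d" "j < N" "t < d" "\<kappa> = [f0 (\<beta> i), i, s]" "\<kappa>' = [f0 (\<beta> j), j, t]"
    | (ab) i s k t where "i < N" "s < d" "k < length r" "t < e k" "\<kappa> = [f0 (\<beta> i), i, s]" "\<kappa>' = [k, N, t]"
    | (ba) i s k t where "i < N" "s < d" "k < length r" "t < e k" "\<kappa>' = [f0 (\<beta> i), i, s]" "\<kappa> = [k, N, t]"
    | (bb) k s k' t where "k < length r" "s < e k" "k' < length r" "t < e k'" "\<kappa> = [k, N, s]" "\<kappa>' = [k', N, t]"
      by (elim UnE imageE SigmaE) (simp_all add: lessThan_iff)
    then show "cinner (w \<kappa>) (w \<kappa>') = (if \<kappa> = \<kappa>' then 1 else 0)"
    proof cases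
      case aa
      then show ?thesis using AA[of i j s t] by auto
    next
      case ab
      then show ?thesis using AB(1)[of i s k t] by auto
    next
      case ba
      then show ?thesis using AB(2)[of i s k t] by auto
    next
      case bb
      then show ?thesis using BB[of k k' s t] by auto
    qed
  qed auto
  \<comment> \<open>Completeness: the keys in \<open>?A\<close> contribute \<open>P a b\<close>,
    those in \<open>?B\<close> the complement \<open>mat 1 - P a b\<close>.\<close>
  have "(\<Sum>\<kappa>\<in>?I. outer (w \<kappa>) (w \<kappa>)) = (\<Sum>\<kappa>\<in>?A. outer (w \<kappa>) (w \<kappa>)) + (\<Sum>\<kappa>\<in>?B. outer (w \<kappa>) (w \<kappa>))"
    by (rule sum.union_disjoint) auto
  also have "(\<Sum>\<kappa>\<in>?A. outer (w \<kappa>) (w \<kappa>)) = (\<Sum>(i, s)\<in>{..<N} \<times> {..<d}.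
      outer (w [f0 (\<beta> i), i, s]) (w [f0 (\<beta> i), i, s]))"
    by (subst sum.reindex) (auto simp: inj_on_def intro!: sum.cong)
  also have "\<dots> = (\<Sum>i<N. G i i ** P a b)"
    unfolding sum.cartesian_product[symmetric] by (intro sum.cong refl) (simp add: units)
  also have "\<dots> = P a b" by (simp add: matrix_sum_mult_left[symmetric] G_sum P_E)
  also have "(\<Sum>\<kappa>\<in>?B. outer (w \<kappa>) (w \<kappa>)) = (\<Sum>(k, s)\<in>(SIGMA k:{..<length r}. {..<e k}).
      outer (z k s) (z k s))"
    by (subst sum.reindex) (auto simp: inj_on_def wB intro!: sum.cong)
  also have "\<dots> = (\<Sum>k<length r. r ! k - r ! k ** P a b)"
    by (subst sum.Sigma[symmetric]) (auto simp: z(2) intro!: sum.cong)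
  also have "\<dots> = mat 1 - P a b"
    by (simp add: sum_subtractf matrix_sum_mult_left[symmetric] ordered_decomposition_sum[OF r])
  finally have "(\<Sum>\<kappa>\<in>?I. outer (w \<kappa>) (w \<kappa>)) = mat 1" by simp
  with on have basis_I: "orthonormal_basis ?I w" by (simp add: orthonormal_basis_def)
  have "adapted_basis r ?I w hd"
    unfolding adapted_basis_def
  proof (intro conjI ballI impI r basis_I)
    fix \<kappa> assume "\<kappa> \<in> ?I"
    then consider (a) i s where "i < N" "s < d" "\<kappa> = [f0 (\<beta> i), i, s]"
      | (b) k s where "k < length r" "s < e k" "\<kappa> = [k, N, s]"
      by (elim UnE imageE SigmaE) (simp_all add: lessThan_iff)
    then have "hd \<kappa> < length r \<and> r ! hd \<kappa> *v w \<kappa> = w \<kappa>"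
    proof cases
      case a
      note l = uniq_less[OF block_less[OF a(1)]]
      have "r ! f0 (\<beta> i) *v (G i 0 *v (P a b *v y s)) = G i 0 *v (P a b *v y s)"
        using atom_G_P[OF a(1) N l] by (simp add: matrix_vector_mul_assoc matrix_mul_assoc)
      then show ?thesis using a l by (simp add: wA Py)
    next
      case b
      then show ?thesis using rz[of k k s] by (simp add: wB)
    qed
    then show "hd \<kappa> < length r" "r ! hd \<kappa> *v w \<kappa> = w \<kappa>" by auto
  next
    fix \<kappa> \<kappa>' assume "\<kappa> \<in> ?I" "\<kappa>' \<in> ?I" "\<kappa> \<le> \<kappa>'"
    then show "hd \<kappa> \<le> hd \<kappa>'" by auto
  qed
  moreover have "\<forall>i<N. \<forall>s<d. [f0 (\<beta> i), i, s] \<in> ?I"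
    by (intro allI impI UnI1 image_eqI[of _ _ "(i, s)" for i s]) auto
  ultimately show ?thesis using units by blast
qed

text \<open>For \<open>i \<le> j\<close> the matrix unit at \<open>(i, j)\<close> goes to a sum that
  matches the keys \<open>[f0 (\<beta> i), i, s]\<close> with \<open>[f0 (\<beta> j), j, s]\<close>,
  both increasing in \<open>s\<close>, hence to an order conserving partial isometry. For
  \<open>i < j\<close> every key of \<open>i\<close> precedes every key of \<open>j\<close>, which
  gives the condition on atoms.\<close>

lemma psi_refinement: "refinement_type q r (\<psi> a b)"
proof -
  obtain I :: "nat list set" and w d where I: "adapted_basis r I w hd"
    and mem': "\<forall>i<N. \<forall>s<d. [f0 (\<beta> i), i, s] \<in> I"
    and units': "\<forall>i<N. \<forall>j<N. G i j ** P a b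
      = (\<Sum>s<d. outer (w [f0 (\<beta> i), i, s]) (w [f0 (\<beta> j), j, s]))"
    using refining_basis by blast
  have mem: "[f0 (\<beta> i), i, s] \<in> I" if "i < N" "s < d" for i s
    using mem' that by blast
  have units: "G i j ** P a b = (\<Sum>s<d. outer (w [f0 (\<beta> i), i, s]) (w [f0 (\<beta> j), j, s]))"
    if "i < N" "j < N" for i j
    using units' that by blast
  define e where "e = atom_list {..<N} u"
  define f where "f = atom_list I w"
  have w: "orthonormal_basis I w" using I by (simp add: adapted_basis_def)
  have le: "f0 (\<beta> i) \<le> f0 (\<beta> j)" if "i \<le> j" "j < N" for i j
    using adapted_basis_mono[OF u, of i j] that by (intro uniq_mono block_less) auto
  have oc_f: "mat c ** (G i j ** P a b) \<in> Pisom_oc f" if ij: "i \<le> j" "j < N" and c: "cnj c * c = 1" for i j c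
  proof -
    have i: "i < N" using ij by simp
    show ?thesis
      unfolding f_def units[OF i ij(2)]
      by (rule Pisom_oc_atom_list_sum[OF w])
         (use le[OF ij] ij i c mem in \<open>auto simp: inj_on_def\<close>)
  qed
  have psi_e: "\<psi> a b (outer (u i) (u j)) = G i j ** P a b" for i j
    by (simp add: \<psi>_def G_def)
  have e_f: "\<psi> a b x \<in> nest_alg f" if x: "x \<in> nest_alg e" for x
  proof -
    have unit: "G i j ** P a b \<in> nest_alg f" if "i \<le> j" "j < N" for i j
      using oc_f[OF that, of 1] by (simp add: Pisom_oc_def Pisom_reg_def)
    have "\<psi> a b x = (\<Sum>i<N. \<Sum>j<N. mat (entry u x i j) ** (G i j ** P a b))"
      by (simp add: \<psi>_def star_hom_expand[of x] matrix_sum_mult_left matrix_mul_assoc)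
    moreover have "entry w (mat (entry u x i j) ** (G i j ** P a b)) k l = 0"
      if kl: "k \<in> I" "l \<in> I" "\<not> k \<le> l" and ij: "i < N" "j < N" for i j k l
    proof (cases "i \<le> j")
      case True
      then show ?thesis
        using unit[OF True ij(2)] kl by (simp add: f_def nest_alg_atom_list[OF w] entry_scale)
    next
      case False
      then have "entry u x i j = 0"
        using x ij by (simp add: e_def nest_alg_atom_list[OF basis])
      then show ?thesis by (simp only: entry_scale) simp
    qed
    ultimately show ?thesis
      by (simp add: f_def nest_alg_atom_list[OF w] entry_sum)
  qed
  have "star_extendible_embedding e f (\<psi> a b)"
    unfolding star_extendible_embedding_def star_extendible_def
    using e_f psi_star_hom psi_inj[OF nz] by (blast intro: inj_on_subset)
  moreover have "locally_order_conserving e f (\<psi> a b)"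
    unfolding locally_order_conserving_def
  proof (intro ballI impI)
    fix v assume v: "v \<in> Pisom_reg e" "rank v = 1"
    obtain c i j where cij: "j < N" "i \<le> j" "cnj c * c = 1" "v = mat c ** outer (u i) (u j)"
      using Pisom_reg_rank_1[OF basis v(1)[unfolded e_def] v(2)] by auto
    have "\<psi> a b v = mat c ** (G i j ** P a b)"
      using star_hom_scale[OF psi_star_hom] by (simp add: cij psi_e)
    then show "\<psi> a b v \<in> Pisom_oc f" using oc_f[OF cij(2,1,3)] by simp
  qed
  moreover have "k < l"
    if ij: "i < j" "j < length e" and kl: "k < length f" "l < length f"
      and le_k: "op_le (f ! k) (\<psi> a b (e ! i))" and le_l: "op_le (f ! l) (\<psi> a b (e ! j))" for i j k l
  proof -
    let ?ix = "\<lambda>k. sorted_list_of_set I ! k"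
    \<comment> \<open>The image of \<open>e ! i\<close> annihilates every basis vector with another
      key, so by \<open>op_le_outer_nonzero\<close> no other atom lies below it.\<close>
    have below: "\<exists>s<d. ?ix k = [f0 (\<beta> i), i, s]"
      if i: "i < N" and k: "k < card I" and le: "op_le (f ! k) (\<psi> a b (e ! i))" for i k
    proof (rule ccontr)
      assume no: "\<not> ?thesis"
      have kI: "?ix k \<in> I" by (rule sorted_list_of_set_nth_mem[OF basis_finite[OF w] k])
      have "sorted_list_of_set {..<N} ! i = i"
        using i by (simp add: lessThan_atLeast0)
      then have "e ! i = outer (u i) (u i)"
        using i by (simp add: e_def atom_list_nth[OF basis])
      then have "\<psi> a b (e ! i) = (\<Sum>s<d. outer (w [f0 (\<beta> i), i, s]) (w [f0 (\<beta> i), i, s]))"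
        using units[OF i i] by (simp add: psi_e)
      moreover have "(\<Sum>s<d. outer (w [f0 (\<beta> i), i, s]) (w [f0 (\<beta> i), i, s])) *v w (?ix k) = 0"
        unfolding matrix_sum_mult_vec
        using no mem[OF i] kI by (intro sum.neutral) (auto simp: basis_cinner[OF w])
      ultimately show False
        using le op_le_outer_nonzero[OF _ basis_nonzero[OF w kI]] k
        by (simp add: f_def atom_list_nth[OF w])
    qed
    have N: "i < N" "j < N" using ij by (simp_all add: e_def length_atom_list[OF basis])
    have card: "k < card I" "l < card I" using kl by (simp_all add: f_def length_atom_list[OF w])
    obtain s t where "?ix k = [f0 (\<beta> i), i, s]" "?ix l = [f0 (\<beta> j), j, t]"
      using below[OF N(1) card(1) le_k] below[OF N(2) card(2) le_l] by blast
    moreover have "f0 (\<beta> i) \<le> f0 (\<beta> j)" using le[of i j] ij N by simp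
    ultimately have "?ix k < ?ix l" using ij(1) by auto
    then show "k < l"
      by (simp only: sorted_list_of_set_nth_less_iff[OF basis_finite[OF w] card])
  qed
  ultimately have "refinement_type_triangular e f (\<psi> a b)"
    unfolding refinement_type_triangular_def by blast
  then show ?thesis
    unfolding refinement_type_def
    using psi_embedding[OF nz] e_f
      atom_list_rank_one_decomposition[OF basis] atom_list_rank_one_decomposition[OF w]
      atom_list_maximal_triangular[OF basis adapted_basis_nest_alg[OF u]]
      atom_list_maximal_triangular[OF w adapted_basis_nest_alg[OF I]]
    unfolding e_def f_def by blast
qed

end

text \<open>If two functions \<open>f0\<close> and \<open>f1\<close> with the pair
  \<open>(a, b)\<close> differ somewhere, then every function with this pair differs from one of
  them, and \<open>F_dichotomy\<close> leaves it only the values \<open>a\<close> and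
  \<open>b\<close>. Otherwise the function is unique.\<close>

lemma psi_dichotomy:
  assumes nz: "P a b \<noteq> 0"
  shows "T2_degenerate_type q r (\<psi> a b) \<or> refinement_type q r (\<psi> a b)"
proof -
  obtain f0 where f0: "f0 \<in> F" "f0 0 = a" "f0 (length q - 1) = b" using F_of_P[OF nz] by blast
  show ?thesis
  proof (cases "\<forall>f\<in>F. f 0 = a \<and> f (length q - 1) = b \<longrightarrow> (\<forall>k<length q. f k = f0 k)")
    case True
    then show ?thesis using psi_refinement[OF nz, of f0] by blast
  next
    case False
    then obtain f1 k1 where f1: "f1 \<in> F" "f1 0 = a" "f1 (length q - 1) = b"
      and k1: "k1 < length q" "f1 k1 \<noteq> f0 k1" by blast
    \<comment> \<open>The values \<open>f0 k1\<close> and \<open>f1 k1\<close> are different and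
      both lie between \<open>a\<close> and \<open>b\<close>.\<close>
    have "a < b"
      using F_between[OF f0(1) k1(1)] F_between[OF f1(1) k1(1)] f0 f1 k1(2) by simp
    have two: "g k \<in> {a, b}"
      if g: "g \<in> F" "g 0 = a" "g (length q - 1) = b" and k: "k < length q" for g k
    proof -
      obtain h where h: "h \<in> F" "h 0 = a" "h (length q - 1) = b" "\<not> (\<forall>i<length q. g i = h i)"
      proof (cases "g k1 = f0 k1")
        case True
        then have "g k1 \<noteq> f1 k1" using k1(2) by simp
        then show ?thesis using that[OF f1] k1(1) by blast
      next
        case False
        then show ?thesis using that[OF f0] k1(1) by blast
      qed
      then show ?thesis
        using F_dichotomy[OF g(1) h(1)] g h \<open>a < b\<close> k by auto
    qed
    have "T2_degenerate_type q r (\<psi> a b)"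
    proof (rule psi_T2_degenerate[OF nz])
      show "a \<noteq> b" using \<open>a < b\<close> by simp
    qed (rule two)
    then show ?thesis ..
  qed
qed

end

section \<open>Assembling the ordered sum\<close>

lemma P_orthogonal:
  assumes "a < length r" "b < length r" "a' < length r" "b' < length r" "(a, b) \<noteq> (a', b')"
  shows "P a b ** P a' b' = 0"
proof -
  have "P a b ** P a' b' = S 0 a ** (S (length q - 1) b ** S 0 a') ** S (length q - 1) b'"
    by (simp only: P_def matrix_mul_assoc)
  also have "\<dots> = (S 0 a ** S 0 a') ** (S (length q - 1) b ** S (length q - 1) b')"
    by (simp only: S_commute[OF last_block length_q assms(2,3)] matrix_mul_assoc)
  finally show ?thesis
    using assms(5) S_mult[OF length_q assms(1,3)] S_mult[OF last_block assms(2,4)]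
    by (auto simp del: One_nat_def)
qed

lemma P_sum: "(\<Sum>a<length r. \<Sum>b<length r. P a b) = E"
proof -
  have "(\<Sum>a<length r. \<Sum>b<length r. P a b) = (\<Sum>a<length r. S 0 a ** E)"
    by (simp only: P_def matrix_sum_mult_right[symmetric] S_sum[OF last_block])
  also have "\<dots> = (\<Sum>a<length r. S 0 a) ** E" by (rule matrix_sum_mult_left[symmetric])
  finally show ?thesis by (simp add: S_sum[OF length_q] E_mult)
qed

text \<open>The summands are the \<open>\<psi> a b\<close> with \<open>P a b \<noteq> 0\<close>, in
  the lexicographic order of the pairs. By \<open>F_dichotomy\<close> the intervals from
  \<open>a\<close> to \<open>b\<close> of two different pairs meet at most in an endpoint, so the
  atoms they use follow one another in this order.\<close>

lemma ordered_sum_decomposition: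
  "\<exists>p \<Psi>. is_ordered_sum q r \<Phi> p \<Psi> \<and>
    (\<forall>i<p. T2_degenerate_type q r (\<Psi> i) \<or> refinement_type q r (\<Psi> i))"
proof -
  let ?L = "length r"
  let ?J = "{(a, b) \<in> {..<?L} \<times> {..<?L}. P a b \<noteq> 0}"
  \<comment> \<open>Two-element lists stand for the pairs because lists carry the lexicographic
    order.\<close>
  define T where "T = (\<lambda>(a, b). [a, b]) ` ?J"
  let ?t = "\<lambda>i. sorted_list_of_set T ! i"
  define \<Psi> where "\<Psi> i = \<psi> (?t i ! 0) (?t i ! 1)" for i
  have finJ: "finite ?J" by (rule finite_subset[of _ "{..<?L} \<times> {..<?L}"]) auto
  then have fin: "finite T" by (simp add: T_def)
  have key: "\<exists>a b. ?t i = [a, b] \<and> \<Psi> i = \<psi> a b \<and> a < ?L \<and> b < ?L \<and> P a b \<noteq> 0" if "i < card T" for i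
    using sorted_list_of_set_nth_mem[OF fin that] unfolding T_def \<Psi>_def by auto
  have "star_extendible q r (\<Psi> i)" if i: "i < card T" for i
    using key[OF i] psi_star_extendible by auto
  moreover have "\<Psi> i (mat 1) ** \<Psi> j (mat 1) = 0" if ij: "i < card T" "j < card T" "i \<noteq> j" for i j
  proof -
    obtain a b a' b' where k: "?t i = [a, b]" "\<Psi> i = \<psi> a b" "a < ?L" "b < ?L"
      "?t j = [a', b']" "\<Psi> j = \<psi> a' b'" "a' < ?L" "b' < ?L"
      using key[OF ij(1)] key[OF ij(2)] by blast
    have "?t i \<noteq> ?t j"
      using sorted_list_of_set_nth_less_iff[OF fin ij(1,2)] sorted_list_of_set_nth_less_iff[OF fin ij(2,1)]
        ij(3) by auto
    then show ?thesis using k P_orthogonal[of a b a' b'] by (simp add: \<psi>_def P_E)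
  qed
  moreover have "\<Phi> x = (\<Sum>i<card T. \<Psi> i x)" for x
  proof -
    have "(\<Sum>i<card T. \<Psi> i x) = (\<Sum>t\<in>T. \<psi> (t ! 0) (t ! 1) x)"
      unfolding \<Psi>_def
      by (rule sum.reindex_bij_betw[of "\<lambda>i. ?t i" "{..<card T}" T "\<lambda>t. \<psi> (t ! 0) (t ! 1) x"])
         (rule bij_betw_nth, use fin in auto)
    also have "\<dots> = (\<Sum>(a, b)\<in>?J. \<Phi> x ** P a b)"
      unfolding T_def by (subst sum.reindex) (auto simp: inj_on_def \<psi>_def intro!: sum.cong)
    also have "\<dots> = (\<Sum>(a, b)\<in>{..<?L} \<times> {..<?L}. \<Phi> x ** P a b)"
      by (rule sum.mono_neutral_left) auto
    also have "\<dots> = \<Phi> x ** (\<Sum>a<?L. \<Sum>b<?L. P a b)"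
      by (simp only: sum.cartesian_product[symmetric] matrix_sum_mult_right)
    finally show ?thesis by (simp add: P_sum E_mult)
  qed
  moreover have "r ! l ** \<Psi> j (mat 1) = 0"
    if kl: "k < l" "l < ?L" and ij: "i < card T" "j < i" and nz: "r ! k ** \<Psi> i (mat 1) \<noteq> 0" for i j k l
  proof (rule ccontr)
    assume nz': "r ! l ** \<Psi> j (mat 1) \<noteq> 0"
    have j: "j < card T" using ij by simp
    obtain a b a' b' where t: "?t i = [a, b]" "\<Psi> i = \<psi> a b" "a < ?L" "b < ?L"
      "?t j = [a', b']" "\<Psi> j = \<psi> a' b'" "a' < ?L" "b' < ?L"
      using key[OF ij(1)] key[OF j] by blast
    have "?t j < ?t i" using sorted_list_of_set_nth_less_iff[OF fin j ij(1)] ij(2) by simp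
    then have lex: "a' < a \<or> a' = a \<and> b' < b" using t by auto
    have k: "k < ?L" using kl by simp
    obtain f m where f: "f \<in> F" "f 0 = a" "f (length q - 1) = b" and m: "m < length q" "f m = k"
      using F_of_atom_P[OF t(3,4) k] nz t by (auto simp: \<psi>_def P_E)
    obtain g m' where g: "g \<in> F" "g 0 = a'" "g (length q - 1) = b'" and m': "m' < length q" "g m' = l"
      using F_of_atom_P[OF t(7,8) kl(2)] nz' t by (auto simp: \<psi>_def P_E)
    have bounds: "a \<le> k" "k \<le> b" "a' \<le> l" "l \<le> b'"
      using F_between[OF f(1) m(1)] F_between[OF g(1) m'(1)] f g m m' by auto
    have "b \<le> a' \<or> b' \<le> a \<or> a = a' \<and> b = b'"
      using F_dichotomy[OF f(1) g(1)] f(2,3) g(2,3) by auto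
    \<comment> \<open>If \<open>b' \<le> a\<close>, then \<open>l \<le> k\<close>. If
      \<open>b \<le> a'\<close>, then \<open>a' \<le> a\<close> forces \<open>a = a'\<close> and
      \<open>a = b\<close>, so \<open>b' < b\<close> contradicts \<open>a' \<le> l\<close> and
      \<open>l \<le> b'\<close>.\<close>
    then show False using bounds lex kl(1) by linarith
  qed
  ultimately have "is_ordered_sum q r \<Phi> (card T) \<Psi>"
    unfolding is_ordered_sum_def by blast
  moreover have "T2_degenerate_type q r (\<Psi> i) \<or> refinement_type q r (\<Psi> i)" if i: "i < card T" for i
    using key[OF i] psi_dichotomy by metis
  ultimately show ?thesis by blast
qed

end

theorem corollary3p10:
  fixes q :: "(complex^'n^'n) list" and r :: "(complex^'m^'m) list"
    and \<phi> :: "complex^'n^'n \<Rightarrow> complex^'m^'m"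
  assumes "ordered_decomposition q" and "ordered_decomposition r"
    and "star_extendible_embedding q r \<phi>"
    and "order_conserving q r \<phi>"
    and "\<forall>x \<in> set q. rank x \<noteq> 1"
  shows "\<exists>p \<psi>. is_ordered_sum q r \<phi> p \<psi> \<and>
           (\<forall>i < p. T2_degenerate_type q r (\<psi> i) \<or> refinement_type q r (\<psi> i))"
proof -
  obtain N u \<beta> where u: "adapted_basis q {..<N::nat} u \<beta>"
    using adapted_basis_exists[OF assms(1)] by blast
  obtain \<Phi> where hom: "star_hom \<Phi>" and ext: "\<And>x. x \<in> nest_alg q \<Longrightarrow> \<phi> x = \<Phi> x"
    using assms(3) by (auto simp: star_extendible_embedding_def star_extendible_def)
  interpret order_conserving_rep q r \<Phi> N u \<beta>
  proof
    show "\<Phi> x \<in> nest_alg r" if "x \<in> nest_alg q" for x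
      using assms(3) that ext[OF that]
      by (auto simp: star_extendible_embedding_def star_extendible_def)
    show "\<Phi> v \<in> Pisom_oc r" if "v \<in> Pisom_oc q" for v
    proof -
      have "v \<in> nest_alg q" using that by (simp add: Pisom_oc_def Pisom_reg_def)
      then show ?thesis using assms(4) that ext by (auto simp: order_conserving_def)
    qed
  qed (use u hom assms in auto)
  \<comment> \<open>An ordered sum depends on \<open>\<phi>\<close> only through its values on
    \<open>nest_alg q\<close>.\<close>
  have "is_ordered_sum q r \<phi> p \<Psi> \<longleftrightarrow> is_ordered_sum q r \<Phi> p \<Psi>" for p \<Psi>
    by (simp add: is_ordered_sum_def ext)
  then show ?thesis using ordered_sum_decomposition by simp
qed

end
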